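(* There exist a countable discrete group $G$ which is solvable and amenable and is not of type I, and an automorphism $\phi: G\to G$, such that the Reidemeister number $R(\phi)$ is finite but $R(\phi)\neq S(\phi)$, where $S(\phi)$ is the number of fixed points of $\widehat{\phi}$ on $\widehat{G}$.
   Context: Let $G$ be a countable discrete group and $\phi: G\to G$ an automorphism. Two elements $x,x'\in G$ are called $\phi$-conjugate (twisted conjugate) if there exists $g\in G$ with $x'=g\,x\,\phi(g^{-1})$; this is an equivalence relation, and the Reidemeister number $R(\phi)$ is the number of its equivalence classes. The unitary dual $\widehat{G}$ is the set of unitary equivalence classes $[\rho]$ of irreducible unitary representations $\rho$ of $G$ on complex Hilbert spaces (finite- or infinite-dimensional). The map $\widehat{\phi}:\widehat{G}\to\widehat{G}$ is defined by $\widehat{\phi}[\rho]=[\rho\circ\phi]$, and $S(\phi)$ is the number of its fixed points, possibly infinite. A discrete group $G$ is of type I if every unitary representation of $G$ generates a von Neumann algebra of type I. *)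

theory Defs
  imports
    "HOL-Analysis.Analysis"
    "HOL-Library.Extended_Nat"
    "HOL-Algebra.Solvable_Groups"
    "HOL-Algebra.Module"
    "HOL-Algebra.Algebraic_Closure_Type"
begin

section \<open>Complex Hilbert spaces\<close>

abbreviation complex_ring :: "complex ring"
  where "complex_ring \<equiv> ring_of_type_algebra"

record 'h hilbert_space = "(complex, 'h) module" +
  cinner :: "'h \<Rightarrow> 'h \<Rightarrow> complex"

definition hnorm :: "'h hilbert_space \<Rightarrow> 'h \<Rightarrow> real"
  where "hnorm H x = sqrt (Re (cinner H x x))"

text \<open>The inner product is linear in its first argument. The fields \<open>mult\<close> and \<open>one\<close>,
  inherited from ring records, are irrelevant.\<close>

locale complex_hilbert = Module.module complex_ring H for H :: "'h hilbert_space" (structure) +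
  assumes cinner_add: "\<lbrakk>x \<in> carrier H; y \<in> carrier H; z \<in> carrier H\<rbrakk>
      \<Longrightarrow> cinner H (x \<oplus> y) z = cinner H x z + cinner H y z"
    and cinner_smult: "\<lbrakk>x \<in> carrier H; y \<in> carrier H\<rbrakk>
      \<Longrightarrow> cinner H (c \<odot> x) y = c * cinner H x y"
    and cinner_commute: "\<lbrakk>x \<in> carrier H; y \<in> carrier H\<rbrakk>
      \<Longrightarrow> cinner H y x = cnj (cinner H x y)"
    and cinner_nonneg: "x \<in> carrier H \<Longrightarrow> 0 \<le> Re (cinner H x x)"
    and cinner_eq_zero: "\<lbrakk>x \<in> carrier H; cinner H x x = 0\<rbrakk> \<Longrightarrow> x = \<zero>"
    and complete: "\<lbrakk>\<And>n::nat. s n \<in> carrier H;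
        \<And>e. e > 0 \<Longrightarrow> \<exists>N. \<forall>m\<ge>N. \<forall>n\<ge>N. hnorm H (s m \<ominus> s n) < e\<rbrakk>
      \<Longrightarrow> \<exists>x\<in>carrier H. (\<lambda>n. hnorm H (s n \<ominus> x)) \<longlonglongrightarrow> 0"

definition closed_subspace :: "'h hilbert_space \<Rightarrow> 'h set \<Rightarrow> bool"
  where "closed_subspace H W \<longleftrightarrow> submodule W complex_ring H \<and>
    (\<forall>s x. (\<forall>n::nat. s n \<in> W) \<and> x \<in> carrier H \<and> (\<lambda>n. hnorm H (s n \<ominus>\<^bsub>H\<^esub> x)) \<longlonglongrightarrow> 0
      \<longrightarrow> x \<in> W)"

text \<open>Operators are total functions of which only the values on the carrier matter; they are
  always compared on the carrier.\<close>

definition linear_operator ::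
    "'h hilbert_space \<Rightarrow> 'k hilbert_space \<Rightarrow> ('h \<Rightarrow> 'k) \<Rightarrow> bool"
  where "linear_operator H K T \<longleftrightarrow> T \<in> carrier H \<rightarrow> carrier K \<and>
    (\<forall>x\<in>carrier H. \<forall>y\<in>carrier H. T (x \<oplus>\<^bsub>H\<^esub> y) = T x \<oplus>\<^bsub>K\<^esub> T y) \<and>
    (\<forall>c. \<forall>x\<in>carrier H. T (c \<odot>\<^bsub>H\<^esub> x) = c \<odot>\<^bsub>K\<^esub> T x)"

definition bounded_operators :: "'h hilbert_space \<Rightarrow> ('h \<Rightarrow> 'h) set"
  where "bounded_operators H =
    {T. linear_operator H H T \<and> (\<exists>B. \<forall>x\<in>carrier H. hnorm H (T x) \<le> B * hnorm H x)}"

definition unitary_operator ::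
    "'h hilbert_space \<Rightarrow> 'k hilbert_space \<Rightarrow> ('h \<Rightarrow> 'k) \<Rightarrow> bool"
  where "unitary_operator H K U \<longleftrightarrow> linear_operator H K U \<and> U ` carrier H = carrier K \<and>
    (\<forall>x\<in>carrier H. \<forall>y\<in>carrier H. cinner K (U x) (U y) = cinner H x y)"


section \<open>Von Neumann algebras of type I\<close>

definition commutant :: "'h hilbert_space \<Rightarrow> ('h \<Rightarrow> 'h) set \<Rightarrow> ('h \<Rightarrow> 'h) set"
  where "commutant H S =
    {T \<in> bounded_operators H. \<forall>A\<in>S. \<forall>x\<in>carrier H. T (A x) = A (T x)}"

text \<open>The von Neumann algebra generated by a set of bounded operators that is closed under
  adjoints (such as the image of a unitary representation).\<close>

definition generated_vN :: "'h hilbert_space \<Rightarrow> ('h \<Rightarrow> 'h) set \<Rightarrow> ('h \<Rightarrow> 'h) set"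
  where "generated_vN H S = commutant H (commutant H S)"

definition nonzero_projection ::
    "'h hilbert_space \<Rightarrow> ('h \<Rightarrow> 'h) set \<Rightarrow> ('h \<Rightarrow> 'h) \<Rightarrow> bool"
  where "nonzero_projection H M P \<longleftrightarrow> P \<in> M \<and>
    (\<forall>x\<in>carrier H. P (P x) = P x) \<and>
    (\<forall>x\<in>carrier H. \<forall>y\<in>carrier H. cinner H (P x) y = cinner H x (P y)) \<and>
    (\<exists>x\<in>carrier H. P x \<noteq> \<zero>\<^bsub>H\<^esub>)"

definition central_in :: "'h hilbert_space \<Rightarrow> ('h \<Rightarrow> 'h) set \<Rightarrow> ('h \<Rightarrow> 'h) \<Rightarrow> bool"
  where "central_in H M Z \<longleftrightarrow> Z \<in> M \<and> (\<forall>A\<in>M. \<forall>x\<in>carrier H. Z (A x) = A (Z x))"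

text \<open>A projection \<open>E\<close> in \<open>M\<close> is abelian if the algebra \<open>E M E\<close> is commutative.\<close>

definition abelian_in :: "'h hilbert_space \<Rightarrow> ('h \<Rightarrow> 'h) set \<Rightarrow> ('h \<Rightarrow> 'h) \<Rightarrow> bool"
  where "abelian_in H M E \<longleftrightarrow>
    (\<forall>A\<in>M. \<forall>B\<in>M. \<forall>x\<in>carrier H. E (A (E (B (E x)))) = E (B (E (A (E x)))))"

text \<open>Type I: every nonzero central projection majorizes a nonzero abelian projection.\<close>

definition vN_type_I :: "'h hilbert_space \<Rightarrow> ('h \<Rightarrow> 'h) set \<Rightarrow> bool"
  where "vN_type_I H M \<longleftrightarrow>
    (\<forall>Z. nonzero_projection H M Z \<and> central_in H M Z \<longrightarrow>
      (\<exists>E. nonzero_projection H M E \<and> abelian_in H M E \<and>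
        (\<forall>x\<in>carrier H. Z (E x) = E x)))"


section \<open>Unitary representations and the unitary dual\<close>

definition unitary_rep ::
    "'g monoid \<Rightarrow> 'h hilbert_space \<Rightarrow> ('g \<Rightarrow> 'h \<Rightarrow> 'h) \<Rightarrow> bool"
  where "unitary_rep G H \<rho> \<longleftrightarrow> complex_hilbert H \<and>
    (\<forall>g\<in>carrier G. unitary_operator H H (\<rho> g)) \<and>
    (\<forall>g\<in>carrier G. \<forall>h\<in>carrier G. \<forall>x\<in>carrier H. \<rho> (g \<otimes>\<^bsub>G\<^esub> h) x = \<rho> g (\<rho> h x))"

definition invariant_subspace ::
    "'g monoid \<Rightarrow> 'h hilbert_space \<Rightarrow> ('g \<Rightarrow> 'h \<Rightarrow> 'h) \<Rightarrow> 'h set \<Rightarrow> bool"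
  where "invariant_subspace G H \<rho> W \<longleftrightarrow>
    closed_subspace H W \<and> (\<forall>g\<in>carrier G. \<rho> g ` W \<subseteq> W)"

definition irreducible_rep ::
    "'g monoid \<Rightarrow> 'h hilbert_space \<Rightarrow> ('g \<Rightarrow> 'h \<Rightarrow> 'h) \<Rightarrow> bool"
  where "irreducible_rep G H \<rho> \<longleftrightarrow> unitary_rep G H \<rho> \<and> carrier H \<noteq> {\<zero>\<^bsub>H\<^esub>} \<and>
    (\<forall>W. invariant_subspace G H \<rho> W \<longrightarrow> W = {\<zero>\<^bsub>H\<^esub>} \<or> W = carrier H)"

definition unitarily_equivalent ::
    "'g monoid \<Rightarrow> 'h hilbert_space \<Rightarrow> ('g \<Rightarrow> 'h \<Rightarrow> 'h)
      \<Rightarrow> 'k hilbert_space \<Rightarrow> ('g \<Rightarrow> 'k \<Rightarrow> 'k) \<Rightarrow> bool"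
  where "unitarily_equivalent G H \<rho> K \<sigma> \<longleftrightarrow>
    (\<exists>U. unitary_operator H K U \<and>
      (\<forall>g\<in>carrier G. \<forall>x\<in>carrier H. U (\<rho> g x) = \<sigma> g (U x)))"

text \<open>HOL has no quantification over all types, so the classes of representations below are
  formed from the Hilbert spaces whose carrier is some subset of \<open>'g \<Rightarrow> complex\<close> (with arbitrary
  operations and inner product). Up to unitary equivalence this includes every cyclic, in
  particular every irreducible, unitary representation on a Hilbert space of any type: see
  \<open>cyclic_rep_universe\<close> and \<open>irreducible_rep_universe\<close>. Cyclic representations also suffice
  to decide whether a group is of type I: if \<open>p\<close> is the largest central projection of the
  enveloping von Neumann algebra below which there is no nonzero abelian projection and
  \<open>p \<noteq> 0\<close>, then the GNS representation of a normal state supported under \<open>p\<close> does not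
  generate a von Neumann algebra of type I.\<close>

type_synonym 'g rep =
  "('g \<Rightarrow> complex) hilbert_space \<times> ('g \<Rightarrow> ('g \<Rightarrow> complex) \<Rightarrow> ('g \<Rightarrow> complex))"

definition irreps :: "'g monoid \<Rightarrow> 'g rep set"
  where "irreps G = {(H, \<rho>). irreducible_rep G H \<rho>}"

definition rep_equiv :: "'g monoid \<Rightarrow> ('g rep \<times> 'g rep) set"
  where "rep_equiv G = {((H, \<rho>), (K, \<sigma>)). (H, \<rho>) \<in> irreps G \<and> (K, \<sigma>) \<in> irreps G \<and>
    unitarily_equivalent G H \<rho> K \<sigma>}"

definition unitary_dual :: "'g monoid \<Rightarrow> 'g rep set set"
  where "unitary_dual G = irreps G // rep_equiv G"

text \<open>The map sending the class of \<open>\<rho>\<close> to the class of \<open>\<rho> \<circ> \<phi>\<close>; see \<open>dual_map_class\<close>.\<close>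

definition dual_map :: "'g monoid \<Rightarrow> ('g \<Rightarrow> 'g) \<Rightarrow> 'g rep set \<Rightarrow> 'g rep set"
  where "dual_map G \<phi> C = rep_equiv G `` {(H, \<rho> \<circ> \<phi>) | H \<rho>. (H, \<rho>) \<in> C}"

definition type_I_group :: "'g monoid \<Rightarrow> bool"
  where "type_I_group G \<longleftrightarrow>
    (\<forall>(H :: ('g \<Rightarrow> complex) hilbert_space) \<rho>. unitary_rep G H \<rho> \<longrightarrow>
      vN_type_I H (generated_vN H (\<rho> ` carrier G)))"


section \<open>Amenability, Reidemeister numbers and fixed points\<close>

text \<open>Amenability of a discrete group: a finitely additive left-invariant probability measure
  on all subsets.\<close>

definition amenable :: "'g monoid \<Rightarrow> bool"
  where "amenable G \<longleftrightarrow> (\<exists>\<mu> :: 'g set \<Rightarrow> real.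
    \<mu> (carrier G) = 1 \<and>
    (\<forall>A. A \<subseteq> carrier G \<longrightarrow> 0 \<le> \<mu> A) \<and>
    (\<forall>A B. A \<subseteq> carrier G \<and> B \<subseteq> carrier G \<and> A \<inter> B = {} \<longrightarrow> \<mu> (A \<union> B) = \<mu> A + \<mu> B) \<and>
    (\<forall>g\<in>carrier G. \<forall>A. A \<subseteq> carrier G \<longrightarrow> \<mu> (g <#\<^bsub>G\<^esub> A) = \<mu> A))"

definition ecard :: "'a set \<Rightarrow> enat"
  where "ecard A = (if finite A then enat (card A) else \<infinity>)"

definition twisted_conjugacy :: "'g monoid \<Rightarrow> ('g \<Rightarrow> 'g) \<Rightarrow> ('g \<times> 'g) set"
  where "twisted_conjugacy G \<phi> = {(x, x'). x \<in> carrier G \<and> x' \<in> carrier G \<and>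
    (\<exists>g\<in>carrier G. x' = g \<otimes>\<^bsub>G\<^esub> x \<otimes>\<^bsub>G\<^esub> \<phi> (inv\<^bsub>G\<^esub> g))}"

definition reidemeister_number :: "'g monoid \<Rightarrow> ('g \<Rightarrow> 'g) \<Rightarrow> enat"
  where "reidemeister_number G \<phi> = ecard (carrier G // twisted_conjugacy G \<phi>)"

definition dual_fixed_points :: "'g monoid \<Rightarrow> ('g \<Rightarrow> 'g) \<Rightarrow> enat"
  where "dual_fixed_points G \<phi> = ecard {C \<in> unitary_dual G. dual_map G \<phi> C = C}"


section \<open>Well-definedness and independence of the carrier type\<close>

lemma complex_ring_simps [simp]:
  "carrier complex_ring = UNIV" "monoid.mult complex_ring = (*)" "one complex_ring = 1"
  "zero complex_ring = 0" "add complex_ring = (+)"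
  by (auto simp: ring_of_type_algebra_def)

lemma (in complex_hilbert) diff_eq:
  assumes "x \<in> carrier H" "y \<in> carrier H"
  shows "x \<ominus> y = x \<oplus> (-1) \<odot> y"
proof -
  have "(1 + -1) \<odot> y = y \<oplus> (-1) \<odot> y"
    using smult_l_distr[of 1 "-1" y] smult_one[of y] assms by simp
  then have "y \<oplus> (-1) \<odot> y = \<zero>" using smult_l_null[of y] assms by simp
  then have "(-1) \<odot> y = \<ominus> y"
    using M.minus_equality[of "(-1) \<odot> y" y] M.a_comm[of y "(-1) \<odot> y"]
      smult_closed[of "-1" y] assms by simp
  then show ?thesis by (simp add: a_minus_def)
qed

lemma (in complex_hilbert) eq_of_diff:
  assumes "x \<in> carrier H" "y \<in> carrier H" "x \<ominus> y = \<zero>"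
  shows "x = y"
proof -
  have "x \<oplus> \<ominus> y = \<zero>" using assms(3) by (simp add: a_minus_def)
  then have "\<ominus> (\<ominus> y) = x" using assms(1,2) by (intro M.minus_equality) auto
  then show ?thesis using assms(2) by (metis M.minus_minus)
qed

lemma (in complex_hilbert) smult_in [simp]: "x \<in> carrier H \<Longrightarrow> c \<odot> x \<in> carrier H"
  using smult_closed[of c x] by simp

lemma (in complex_hilbert) cinner_add_right:
  assumes "x \<in> carrier H" "y \<in> carrier H" "z \<in> carrier H"
  shows "cinner H z (x \<oplus> y) = cinner H z x + cinner H z y"
  using cinner_commute[of "x \<oplus> y" z] cinner_commute[of x z] cinner_commute[of y z]
    cinner_add[of x y z] assms by simp

lemma (in complex_hilbert) cinner_smult_right:
  assumes "x \<in> carrier H" "z \<in> carrier H"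
  shows "cinner H z (c \<odot> x) = cnj c * cinner H z x"
  using cinner_commute[of "c \<odot> x" z] cinner_commute[of x z]
    cinner_smult[of x z c] assms by simp

lemma (in complex_hilbert) cinner_zero_left [simp]:
  "x \<in> carrier H \<Longrightarrow> cinner H \<zero> x = 0"
  using cinner_add[of \<zero> \<zero> x] by simp

lemma (in complex_hilbert) cinner_diff:
  assumes "x \<in> carrier H" "y \<in> carrier H" "z \<in> carrier H"
  shows "cinner H (x \<ominus> y) z = cinner H x z - cinner H y z"
  using assms by (simp add: diff_eq cinner_add cinner_smult)

lemma (in complex_hilbert) cinner_self:
  assumes "x \<in> carrier H"
  shows "cinner H x x = complex_of_real ((hnorm H x)\<^sup>2)"
  using cinner_commute[OF assms assms] cinner_nonneg[OF assms]
  by (simp add: hnorm_def complex_eq_iff)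

lemma (in complex_hilbert) cauchy_schwarz:
  assumes x: "x \<in> carrier H" and y: "y \<in> carrier H"
  shows "cmod (cinner H x y) \<le> hnorm H x * hnorm H y"
proof (cases "hnorm H x = 0")
  case True
  then have "x = \<zero>" using cinner_self[OF x] cinner_eq_zero[OF x] by simp
  then show ?thesis using y True by simp
next
  case False
  define p where "p = hnorm H x"
  have p: "p > 0" using False cinner_nonneg[OF x] by (auto simp: p_def hnorm_def less_le)
  define w where "w = cinner H x y"
  define c where "c = - cnj w / of_real (p\<^sup>2)"
  have yx: "cinner H y x = cnj w" using cinner_commute[OF x y] by (simp add: w_def)
  have w_eq: "w * cnj w = of_real ((cmod w)\<^sup>2)"
    using complex_norm_square[of w] by simp
  have "cinner H (y \<oplus> c \<odot> x) (y \<oplus> c \<odot> x)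
      = cinner H y y + cnj c * cinner H y x + c * cinner H x y + c * cnj c * cinner H x x"
    using x y by (simp add: cinner_add cinner_add_right cinner_smult cinner_smult_right)
      (simp add: algebra_simps)
  also have "\<dots> = of_real ((hnorm H y)\<^sup>2) + cnj c * cnj w + c * w + c * cnj c * of_real (p\<^sup>2)"
    using x y by (simp add: cinner_self yx flip: w_def p_def)
  also have "\<dots> = of_real ((hnorm H y)\<^sup>2) - (w * cnj w) / of_real (p\<^sup>2)"
    using p by (simp add: c_def field_simps power2_eq_square)
  also have "\<dots> = of_real ((hnorm H y)\<^sup>2 - (cmod w)\<^sup>2 / p\<^sup>2)"
    by (simp add: w_eq)
  finally have "0 \<le> (hnorm H y)\<^sup>2 - (cmod w)\<^sup>2 / p\<^sup>2"
    using cinner_nonneg[of "y \<oplus> c \<odot> x"] x y by (simp del: of_real_diff of_real_power)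
  then have "(cmod w)\<^sup>2 \<le> (p * hnorm H y)\<^sup>2"
    using p by (simp add: field_simps)
  moreover have "0 \<le> p * hnorm H y"
    using p cinner_nonneg[OF y] by (simp add: hnorm_def)
  ultimately show ?thesis unfolding w_def[symmetric] p_def[symmetric]
    by (rule power2_le_imp_le)
qed

lemma (in complex_hilbert) cinner_limit_zero:
  assumes s: "\<And>n::nat. s n \<in> carrier H" "\<And>n. cinner H (s n) z = 0"
    and x: "x \<in> carrier H" and z: "z \<in> carrier H"
    and lim: "(\<lambda>n. hnorm H (s n \<ominus> x)) \<longlonglongrightarrow> 0"
  shows "cinner H x z = 0"
proof -
  have "cmod (cinner H x z) \<le> hnorm H (s n \<ominus> x) * hnorm H z" for n
    using cauchy_schwarz[of "s n \<ominus> x" z] cinner_diff[of "s n" x z] s x z by simp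
  moreover have "(\<lambda>n. hnorm H (s n \<ominus> x) * hnorm H z) \<longlonglongrightarrow> 0"
    using tendsto_mult_right[OF lim, of "hnorm H z"] by simp
  ultimately have "cmod (cinner H x z) \<le> 0"
    by (intro tendsto_lowerbound[where F = sequentially]) auto
  then show ?thesis by simp
qed

lemma unitaryD:
  assumes "unitary_operator H K U"
  shows "x \<in> carrier H \<Longrightarrow> U x \<in> carrier K"
    "\<lbrakk>x \<in> carrier H; y \<in> carrier H\<rbrakk> \<Longrightarrow> U (x \<oplus>\<^bsub>H\<^esub> y) = U x \<oplus>\<^bsub>K\<^esub> U y"
    "x \<in> carrier H \<Longrightarrow> U (c \<odot>\<^bsub>H\<^esub> x) = c \<odot>\<^bsub>K\<^esub> U x"
    "\<lbrakk>x \<in> carrier H; y \<in> carrier H\<rbrakk> \<Longrightarrow> cinner K (U x) (U y) = cinner H x y"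
    "U ` carrier H = carrier K"
    "x \<in> carrier H \<Longrightarrow> hnorm K (U x) = hnorm H x"
  using assms by (auto simp: unitary_operator_def linear_operator_def hnorm_def)

lemma unitary_diff:
  assumes "complex_hilbert H" "complex_hilbert K" "unitary_operator H K U"
    and "x \<in> carrier H" "y \<in> carrier H"
  shows "U (x \<ominus>\<^bsub>H\<^esub> y) = U x \<ominus>\<^bsub>K\<^esub> U y"
proof -
  interpret H: complex_hilbert H by fact
  interpret K: complex_hilbert K by fact
  show ?thesis using assms(4,5) unitaryD[OF assms(3)]
    by (simp add: H.diff_eq K.diff_eq)
qed

lemma unitary_zero:
  assumes "complex_hilbert H" "complex_hilbert K" "unitary_operator H K U"
  shows "U \<zero>\<^bsub>H\<^esub> = \<zero>\<^bsub>K\<^esub>"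
proof -
  interpret H: complex_hilbert H by fact
  interpret K: complex_hilbert K by fact
  have "U \<zero>\<^bsub>H\<^esub> \<in> carrier K" using unitaryD(1)[OF assms(3)] by simp
  moreover have "U \<zero>\<^bsub>H\<^esub> \<oplus>\<^bsub>K\<^esub> U \<zero>\<^bsub>H\<^esub> = U \<zero>\<^bsub>H\<^esub>"
    using unitaryD(2)[OF assms(3), of "\<zero>\<^bsub>H\<^esub>" "\<zero>\<^bsub>H\<^esub>"] by simp
  ultimately show ?thesis by (metis K.M.add.r_cancel_one)
qed

lemma unitary_inj:
  assumes "complex_hilbert H" "unitary_operator H K U"
  shows "inj_on U (carrier H)"
proof (rule inj_onI)
  interpret H: complex_hilbert H by fact
  fix x y assume x: "x \<in> carrier H" and y: "y \<in> carrier H" and eq: "U x = U y"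
  have *: "cinner H x z = cinner H y z" if "z \<in> carrier H" for z
    using unitaryD(4)[OF assms(2)] x y that eq by metis
  have "cinner H (x \<ominus>\<^bsub>H\<^esub> y) (x \<ominus>\<^bsub>H\<^esub> y) = 0"
    using * x y by (simp add: H.cinner_diff)
  then have "x \<ominus>\<^bsub>H\<^esub> y = \<zero>\<^bsub>H\<^esub>" using H.cinner_eq_zero[of "x \<ominus>\<^bsub>H\<^esub> y"] x y by simp
  then show "x = y" using x y H.eq_of_diff by blast
qed

lemma unitary_inv:
  assumes "complex_hilbert H" "complex_hilbert K" and U: "unitary_operator H K U"
  shows "unitary_operator K H (inv_into (carrier H) U)" (is "unitary_operator K H ?V")
proof -
  interpret H: complex_hilbert H by fact
  interpret K: complex_hilbert K by fact
  note u = unitaryD[OF U]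
  have V: "?V (U x) = x" if "x \<in> carrier H" for x
    using unitary_inj[OF assms(1) U] that by simp
  have ex: "\<exists>x\<in>carrier H. y = U x" if "y \<in> carrier K" for y using that u(5) by auto
  have im: "?V ` carrier K = carrier H"
    unfolding u(5)[symmetric] by (simp add: image_image V)
  have 1: "?V (a \<oplus>\<^bsub>K\<^esub> b) = ?V a \<oplus>\<^bsub>H\<^esub> ?V b" if ab: "a \<in> carrier K" "b \<in> carrier K" for a b
  proof -
    obtain x y where "x \<in> carrier H" "a = U x" "y \<in> carrier H" "b = U y" using ab ex by metis
    then show ?thesis by (simp add: V flip: u(2))
  qed
  have 2: "?V (c \<odot>\<^bsub>K\<^esub> a) = c \<odot>\<^bsub>H\<^esub> ?V a" if a: "a \<in> carrier K" for c a
  proof -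
    obtain x where "x \<in> carrier H" "a = U x" using a ex by metis
    then show ?thesis by (simp add: V flip: u(3))
  qed
  have 3: "cinner H (?V a) (?V b) = cinner K a b" if ab: "a \<in> carrier K" "b \<in> carrier K" for a b
  proof -
    obtain x y where "x \<in> carrier H" "a = U x" "y \<in> carrier H" "b = U y" using ab ex by metis
    then show ?thesis by (simp add: V u(4))
  qed
  show ?thesis unfolding unitary_operator_def linear_operator_def
    using im 1 2 3 by auto
qed

lemma unitary_comp:
  assumes "unitary_operator H K U" "unitary_operator K L V"
  shows "unitary_operator H L (V \<circ> U)"
proof -
  have "(V \<circ> U) ` carrier H = carrier L"
    unfolding image_comp[symmetric] unitaryD(5)[OF assms(1)] unitaryD(5)[OF assms(2)] ..
  then show ?thesis
    unfolding unitary_operator_def linear_operator_def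
    by (auto simp: unitaryD(1-4)[OF assms(1)] unitaryD(1-4)[OF assms(2)])
qed

lemma unitary_id: "unitary_operator H H (\<lambda>x. x)"
  by (auto simp: unitary_operator_def linear_operator_def)

lemma unitarily_equivalent_refl: "unitarily_equivalent G H \<rho> H \<rho>"
  unfolding unitarily_equivalent_def using unitary_id by blast

lemma unitarily_equivalent_trans:
  assumes "unitarily_equivalent G H \<rho> K \<sigma>" "unitarily_equivalent G K \<sigma> L \<tau>"
  shows "unitarily_equivalent G H \<rho> L \<tau>"
proof -
  from assms obtain U V where U: "unitary_operator H K U"
      "\<And>g x. g \<in> carrier G \<Longrightarrow> x \<in> carrier H \<Longrightarrow> U (\<rho> g x) = \<sigma> g (U x)"
    and V: "unitary_operator K L V"
      "\<And>g x. g \<in> carrier G \<Longrightarrow> x \<in> carrier K \<Longrightarrow> V (\<sigma> g x) = \<tau> g (V x)"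
    unfolding unitarily_equivalent_def by blast
  show ?thesis unfolding unitarily_equivalent_def
    using unitary_comp[OF U(1) V(1)] U(2) V(2) unitaryD(1)[OF U(1)]
    by (intro exI[of _ "V \<circ> U"]) auto
qed

lemma unitarily_equivalent_sym:
  assumes "unitary_rep G H \<rho>" "complex_hilbert K" "unitarily_equivalent G H \<rho> K \<sigma>"
  shows "unitarily_equivalent G K \<sigma> H \<rho>"
proof -
  have H: "complex_hilbert H" using assms(1) by (simp add: unitary_rep_def)
  from assms(3) obtain U where U: "unitary_operator H K U"
      "\<And>g x. g \<in> carrier G \<Longrightarrow> x \<in> carrier H \<Longrightarrow> U (\<rho> g x) = \<sigma> g (U x)"
    unfolding unitarily_equivalent_def by blast
  let ?V = "inv_into (carrier H) U"
  have V: "?V (U x) = x" if "x \<in> carrier H" for x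
    using unitary_inj[OF H U(1)] that by simp
  have "?V (\<sigma> g y) = \<rho> g (?V y)" if g: "g \<in> carrier G" and y: "y \<in> carrier K" for g y
  proof -
    obtain x where x: "x \<in> carrier H" "y = U x" using y unitaryD(5)[OF U(1)] by auto
    have "\<rho> g x \<in> carrier H"
      using assms(1) g x(1) unitaryD(1) unfolding unitary_rep_def by metis
    then show ?thesis using x U(2)[OF g x(1)] V by metis
  qed
  then show ?thesis unfolding unitarily_equivalent_def
    using unitary_inv[OF H assms(2) U(1)] by blast
qed

lemma equiv_rep_equiv: "equiv (irreps G) (rep_equiv G)"
proof (rule equivI)
  show "rep_equiv G \<subseteq> irreps G \<times> irreps G" by (auto simp: rep_equiv_def)
  show "refl_on (irreps G) (rep_equiv G)"
    by (auto simp: refl_on_def rep_equiv_def unitarily_equivalent_refl)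
  show "sym (rep_equiv G)"
    by (auto simp: sym_def rep_equiv_def irreps_def irreducible_rep_def unitary_rep_def
        intro!: unitarily_equivalent_sym)
  show "trans (rep_equiv G)"
    by (auto simp: trans_def rep_equiv_def intro: unitarily_equivalent_trans)
qed

lemma irreducible_rep_transfer:
  assumes irr: "irreducible_rep G H \<rho>" and K: "unitary_rep G K \<sigma>"
    and "unitarily_equivalent G H \<rho> K \<sigma>"
  shows "irreducible_rep G K \<sigma>"
proof -
  have Hh: "complex_hilbert H" and Kh: "complex_hilbert K"
    using assms by (auto simp: irreducible_rep_def unitary_rep_def)
  interpret H: complex_hilbert H by fact
  interpret K: complex_hilbert K by fact
  from assms(3) obtain U where U: "unitary_operator H K U"
      "\<And>g x. g \<in> carrier G \<Longrightarrow> x \<in> carrier H \<Longrightarrow> U (\<rho> g x) = \<sigma> g (U x)"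
    unfolding unitarily_equivalent_def by blast
  note u = unitaryD[OF U(1)] and u0 = unitary_zero[OF Hh Kh U(1)]
    and ud = unitary_diff[OF Hh Kh U(1)]
  have r: "\<rho> g x \<in> carrier H" if "g \<in> carrier G" "x \<in> carrier H" for g x
    using irr that unitaryD(1) unfolding irreducible_rep_def unitary_rep_def by metis
  have nz: "carrier K \<noteq> {\<zero>\<^bsub>K\<^esub>}"
  proof
    assume k: "carrier K = {\<zero>\<^bsub>K\<^esub>}"
    have "x = \<zero>\<^bsub>H\<^esub>" if x: "x \<in> carrier H" for x
    proof -
      have "U x = U \<zero>\<^bsub>H\<^esub>" using u(1)[OF x] k u0 by simp
      then show ?thesis using unitary_inj[OF Hh U(1)] x by (auto dest: inj_onD)
    qed
    then have "carrier H = {\<zero>\<^bsub>H\<^esub>}" using H.M.zero_closed by auto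
    then show False using irr by (simp add: irreducible_rep_def)
  qed
  have "W = {\<zero>\<^bsub>K\<^esub>} \<or> W = carrier K" if W: "invariant_subspace G K \<sigma> W" for W
  proof -
    define V where "V = {x \<in> carrier H. U x \<in> W}"
    have sub: "submodule W complex_ring K"
      using W by (simp add: invariant_subspace_def closed_subspace_def)
    have cl: "x \<in> W" if "\<And>n. s n \<in> W" "x \<in> carrier K"
        "(\<lambda>n. hnorm K (s n \<ominus>\<^bsub>K\<^esub> x)) \<longlonglongrightarrow> 0" for s x
      using W that unfolding invariant_subspace_def closed_subspace_def by blast
    note w = K.submoduleE[OF sub]
    have W0: "\<zero>\<^bsub>K\<^esub> \<in> W" using submodule.axioms(1)[OF sub] subgroup.one_closed by fastforce
    have img: "U ` V = W" using w(1) u(5) by (auto simp: V_def)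
    have "submodule V complex_ring H"
    proof (rule H.submoduleI)
      show "\<ominus>\<^bsub>H\<^esub> a \<in> V" if "a \<in> V" for a
      proof -
        have a: "a \<in> carrier H" "U a \<in> W" using that by (auto simp: V_def)
        have "\<ominus>\<^bsub>H\<^esub> a = \<zero>\<^bsub>H\<^esub> \<ominus>\<^bsub>H\<^esub> a" using a by (simp add: a_minus_def)
        then have "\<ominus>\<^bsub>H\<^esub> a = (-1) \<odot>\<^bsub>H\<^esub> a" using a by (simp add: H.diff_eq)
        then show ?thesis using a w(4)[of "-1" "U a"] u(3) by (simp add: V_def)
      qed
    qed (use W0 u0 u w in \<open>auto simp: V_def\<close>)
    moreover have "x \<in> V" if s: "\<And>n. s n \<in> V" and x: "x \<in> carrier H"
        and lim: "(\<lambda>n. hnorm H (s n \<ominus>\<^bsub>H\<^esub> x)) \<longlonglongrightarrow> 0" for s :: "nat \<Rightarrow> _" and x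
    proof -
      have sH: "s n \<in> carrier H" for n using s by (simp add: V_def)
      have "hnorm K (U (s n) \<ominus>\<^bsub>K\<^esub> U x) = hnorm H (s n \<ominus>\<^bsub>H\<^esub> x)" for n
        using ud[OF sH[of n] x] u(6)[of "s n \<ominus>\<^bsub>H\<^esub> x"] sH[of n] x by simp
      then have "U x \<in> W" using cl[of "\<lambda>n. U (s n)" "U x"] lim s u(1)[OF x] by (simp add: V_def)
      then show ?thesis using x by (simp add: V_def)
    qed
    moreover have "\<rho> g ` V \<subseteq> V" if g: "g \<in> carrier G" for g
    proof -
      have "\<sigma> g y \<in> W" if "y \<in> W" for y
        using W g that unfolding invariant_subspace_def by blast
      then show ?thesis using g U(2) r by (auto simp: V_def)
    qed
    ultimately have "invariant_subspace G H \<rho> V"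
      unfolding invariant_subspace_def closed_subspace_def by blast
    then have "V = {\<zero>\<^bsub>H\<^esub>} \<or> V = carrier H" using irr by (simp add: irreducible_rep_def)
    then show ?thesis using img u0 u(5) by auto
  qed
  then show ?thesis using K nz by (simp add: irreducible_rep_def)
qed

definition transport :: "('h \<Rightarrow> 'k) \<Rightarrow> 'h hilbert_space \<Rightarrow> 'k hilbert_space" where
  "transport f H = (let r = inv_into (carrier H) f in
    \<lparr>carrier = f ` carrier H, monoid.mult = (\<lambda>a b. a), one = f \<zero>\<^bsub>H\<^esub>, zero = f \<zero>\<^bsub>H\<^esub>,
     add = (\<lambda>a b. f (r a \<oplus>\<^bsub>H\<^esub> r b)), smult = (\<lambda>c a. f (c \<odot>\<^bsub>H\<^esub> r a)),
     cinner = (\<lambda>a b. cinner H (r a) (r b))\<rparr>)"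

lemma transport_hilbert:
  assumes "complex_hilbert H" "inj_on f (carrier H)"
  shows "complex_hilbert (transport f H)" "unitary_operator H (transport f H) f"
proof -
  interpret H: complex_hilbert H by fact
  let ?K = "transport f H"
  have r: "inv_into (carrier H) f (f x) = x" if "x \<in> carrier H" for x using assms(2) that by simp
  have c: "carrier ?K = f ` carrier H" and z: "\<zero>\<^bsub>?K\<^esub> = f \<zero>\<^bsub>H\<^esub>"
    by (simp_all add: transport_def Let_def)
  have a: "f x \<oplus>\<^bsub>?K\<^esub> f y = f (x \<oplus>\<^bsub>H\<^esub> y)" if "x \<in> carrier H" "y \<in> carrier H" for x y
    using that by (simp add: transport_def Let_def r)
  have m: "k \<odot>\<^bsub>?K\<^esub> f x = f (k \<odot>\<^bsub>H\<^esub> x)" if "x \<in> carrier H" for x k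
    using that by (simp add: transport_def Let_def r)
  have i: "cinner ?K (f x) (f y) = cinner H x y" if "x \<in> carrier H" "y \<in> carrier H" for x y
    using that by (simp add: transport_def Let_def r)
  show u: "unitary_operator H ?K f"
    unfolding unitary_operator_def linear_operator_def by (auto simp: c a m i)
  have ag: "abelian_group ?K"
  proof (rule abelian_groupI)
    fix x assume "x \<in> carrier ?K"
    then obtain x' where x': "x' \<in> carrier H" "x = f x'" by (auto simp: c)
    show "\<exists>y\<in>carrier ?K. y \<oplus>\<^bsub>?K\<^esub> x = \<zero>\<^bsub>?K\<^esub>"
      using x' by (intro bexI[of _ "f (\<ominus>\<^bsub>H\<^esub> x')"]) (auto simp: a c z H.M.l_neg)
  next
    fix x y assume "x \<in> carrier ?K" "y \<in> carrier ?K"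
    then obtain x' y' where "x' \<in> carrier H" "x = f x'" "y' \<in> carrier H" "y = f y'"
      unfolding c by blast
    then show "x \<oplus>\<^bsub>?K\<^esub> y = y \<oplus>\<^bsub>?K\<^esub> x"
      using H.M.a_comm[of x' y'] by (simp add: a)
  qed (auto simp: c z a H.M.a_assoc)
  have mod: "Module.module complex_ring ?K"
    by (rule moduleI[OF H.R.is_cring ag])
      (use H.smult_l_distr H.smult_r_distr H.smult_assoc1 H.smult_one in \<open>auto simp: c a m\<close>)
  interpret K: Module.module complex_ring ?K by fact
  have d: "f x \<ominus>\<^bsub>?K\<^esub> f y = f (x \<ominus>\<^bsub>H\<^esub> y)" if x: "x \<in> carrier H" and y: "y \<in> carrier H" for x y
  proof -
    have "f (\<ominus>\<^bsub>H\<^esub> y) = \<ominus>\<^bsub>?K\<^esub> f y"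
      using y by (intro K.M.minus_equality[symmetric]) (auto simp: a c z H.M.l_neg)
    then show ?thesis using x y by (simp add: a_minus_def flip: a)
  qed
  have n: "hnorm ?K (f x) = hnorm H x" if "x \<in> carrier H" for x
    using that by (simp add: hnorm_def i)
  show "complex_hilbert ?K"
  proof (intro complex_hilbert.intro complex_hilbert_axioms.intro)
    show "Module.module complex_ring ?K" by (rule mod)
    fix s :: "nat \<Rightarrow> _"
    assume s: "\<And>n. s n \<in> carrier ?K"
      and cau: "\<And>e. e > 0 \<Longrightarrow> \<exists>N. \<forall>m\<ge>N. \<forall>n\<ge>N. hnorm ?K (s m \<ominus>\<^bsub>?K\<^esub> s n) < e"
    obtain t where t: "\<And>n. t n \<in> carrier H" "\<And>n. s n = f (t n)"
      using s unfolding c image_iff by metis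
    have "hnorm ?K (s m \<ominus>\<^bsub>?K\<^esub> s n) = hnorm H (t m \<ominus>\<^bsub>H\<^esub> t n)" for m n
      using t by (simp add: d n)
    then obtain x where x: "x \<in> carrier H" "(\<lambda>n. hnorm H (t n \<ominus>\<^bsub>H\<^esub> x)) \<longlonglongrightarrow> 0"
      using H.complete[of t] t(1) cau by auto
    have "hnorm ?K (s m \<ominus>\<^bsub>?K\<^esub> f x) = hnorm H (t m \<ominus>\<^bsub>H\<^esub> x)" for m
      using t x by (simp add: d n)
    then show "\<exists>y\<in>carrier ?K. (\<lambda>n. hnorm ?K (s n \<ominus>\<^bsub>?K\<^esub> y)) \<longlonglongrightarrow> 0"
      using x by (intro bexI[of _ "f x"]) (auto simp: c)
  next
    fix x y assume "x \<in> carrier ?K" "y \<in> carrier ?K"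
    then obtain x' y' where "x' \<in> carrier H" "x = f x'" "y' \<in> carrier H" "y = f y'"
      unfolding c by blast
    then show "cinner ?K y x = cnj (cinner ?K x y)"
      using H.cinner_commute[of x' y'] by (simp add: i)
  next
    fix x assume "x \<in> carrier ?K" "cinner ?K x x = 0"
    then obtain x' where "x' \<in> carrier H" "x = f x'" "cinner H x' x' = 0"
      unfolding c by (auto simp: i)
    then show "x = \<zero>\<^bsub>?K\<^esub>" using H.cinner_eq_zero[of x'] by (simp add: z)
  qed (auto simp: c a m i z H.cinner_add H.cinner_smult H.cinner_nonneg)
qed

text \<open>A vector is cyclic if it lies in no proper invariant subspace.\<close>

lemma cyclic_rep_universe:
  fixes G :: "'g monoid" and H :: "'h hilbert_space"
  assumes G: "group G" and rep: "unitary_rep G H \<rho>" and v: "v \<in> carrier H"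
    and cyclic: "\<And>W. \<lbrakk>invariant_subspace G H \<rho> W; v \<in> W\<rbrakk> \<Longrightarrow> W = carrier H"
  shows "\<exists>(K :: ('g \<Rightarrow> complex) hilbert_space) \<sigma>.
    unitary_rep G K \<sigma> \<and> unitarily_equivalent G H \<rho> K \<sigma>"
proof -
  interpret G: group G by fact
  have Hh: "complex_hilbert H" using rep by (simp add: unitary_rep_def)
  interpret H: complex_hilbert H by fact
  have U: "unitary_operator H H (\<rho> g)" if "g \<in> carrier G" for g
    using rep that by (simp add: unitary_rep_def)
  have mult: "\<rho> (g \<otimes>\<^bsub>G\<^esub> h) x = \<rho> g (\<rho> h x)"
    if "g \<in> carrier G" "h \<in> carrier G" "x \<in> carrier H" for g h x
    using rep that by (simp add: unitary_rep_def)
  note r = unitaryD[OF U] and r0 = unitary_zero[OF Hh Hh U] and rd = unitary_diff[OF Hh Hh U]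
  define f where "f x g = (if g \<in> carrier G then cinner H x (\<rho> g v) else 0)" for x g
  have inj: "inj_on f (carrier H)"
  proof (rule inj_onI)
    fix x y assume x: "x \<in> carrier H" and y: "y \<in> carrier H" and eq: "f x = f y"
    define z where "z = x \<ominus>\<^bsub>H\<^esub> y"
    have z: "z \<in> carrier H" using x y by (simp add: z_def)
    have perp: "cinner H z (\<rho> g v) = 0" if g: "g \<in> carrier G" for g
      using fun_cong[OF eq, of g] g x y v r(1)[OF g v] by (simp add: f_def z_def H.cinner_diff)
    define W where "W = {w \<in> carrier H. \<forall>g\<in>carrier G. cinner H (\<rho> g w) z = 0}"
    have "submodule W complex_ring H"
    proof (rule H.submoduleI)
      show "\<ominus>\<^bsub>H\<^esub> a \<in> W" if a: "a \<in> W" for a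
      proof -
        have aH: "a \<in> carrier H" using a by (simp add: W_def)
        have "\<ominus>\<^bsub>H\<^esub> a = \<zero>\<^bsub>H\<^esub> \<ominus>\<^bsub>H\<^esub> a" using aH by (simp add: a_minus_def)
        then have "\<ominus>\<^bsub>H\<^esub> a = (-1) \<odot>\<^bsub>H\<^esub> a" using aH by (simp add: H.diff_eq)
        then show ?thesis using a z r by (simp add: W_def H.cinner_smult)
      qed
    qed (use z r0 in \<open>auto simp: W_def r H.cinner_add H.cinner_smult\<close>)
    moreover have "w \<in> W" if s: "\<And>n. s n \<in> W" and w: "w \<in> carrier H"
        and lim: "(\<lambda>n. hnorm H (s n \<ominus>\<^bsub>H\<^esub> w)) \<longlonglongrightarrow> 0" for s :: "nat \<Rightarrow> _" and w
    proof -
      have sH: "s n \<in> carrier H" for n using s by (simp add: W_def)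
      have "cinner H (\<rho> g w) z = 0" if g: "g \<in> carrier G" for g
      proof (rule H.cinner_limit_zero[where s = "\<lambda>n. \<rho> g (s n)"])
        have "hnorm H (\<rho> g (s n) \<ominus>\<^bsub>H\<^esub> \<rho> g w) = hnorm H (s n \<ominus>\<^bsub>H\<^esub> w)" for n
          using rd[OF g sH[of n] w] r(6)[OF g, of "s n \<ominus>\<^bsub>H\<^esub> w"] sH[of n] w by simp
        then show "(\<lambda>n. hnorm H (\<rho> g (s n) \<ominus>\<^bsub>H\<^esub> \<rho> g w)) \<longlonglongrightarrow> 0" using lim by simp
      qed (use s g r(1) sH w z in \<open>auto simp: W_def\<close>)
      then show ?thesis using w by (simp add: W_def)
    qed
    moreover have "\<rho> g ` W \<subseteq> W" if "g \<in> carrier G" for g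
      using that r(1) by (auto simp: W_def simp flip: mult)
    ultimately have "invariant_subspace G H \<rho> W"
      unfolding invariant_subspace_def closed_subspace_def by blast
    moreover have "v \<in> W"
      using v perp z r(1) H.cinner_commute[OF z] by (auto simp: W_def)
    ultimately have "z \<in> W" using cyclic z by blast
    then have "cinner H (\<rho> \<one>\<^bsub>G\<^esub> z) z = 0" by (simp add: W_def)
    moreover have "\<rho> \<one>\<^bsub>G\<^esub> z = z"
    proof -
      have "\<rho> \<one>\<^bsub>G\<^esub> (\<rho> \<one>\<^bsub>G\<^esub> z) = \<rho> \<one>\<^bsub>G\<^esub> z"
        using mult[of "\<one>\<^bsub>G\<^esub>" "\<one>\<^bsub>G\<^esub>" z] z by simp
      then show ?thesis
        using unitary_inj[OF Hh U[OF G.one_closed]] z r(1)[OF G.one_closed z] by (auto dest: inj_onD)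
    qed
    ultimately have "z = \<zero>\<^bsub>H\<^esub>" using H.cinner_eq_zero[OF z] by simp
    then show "x = y" using x y H.eq_of_diff unfolding z_def by blast
  qed
  define K where "K = transport f H"
  define \<sigma> where "\<sigma> g = f \<circ> \<rho> g \<circ> inv_into (carrier H) f" for g
  have Kh: "complex_hilbert K" and fu: "unitary_operator H K f"
    using transport_hilbert[OF Hh inj] by (simp_all add: K_def)
  note fu' = unitary_inv[OF Hh Kh fu]
  have "unitary_operator K K (\<sigma> g)" if "g \<in> carrier G" for g
    unfolding \<sigma>_def by (intro unitary_comp[OF fu'] unitary_comp[OF U fu] that)
  moreover have "\<sigma> (g \<otimes>\<^bsub>G\<^esub> h) y = \<sigma> g (\<sigma> h y)"
    if "g \<in> carrier G" "h \<in> carrier G" "y \<in> carrier K" for g h y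
    using that mult[of g h] unitaryD(1)[OF fu'] r(1) inj by (simp add: \<sigma>_def)
  ultimately have "unitary_rep G K \<sigma>" using Kh by (simp add: unitary_rep_def)
  moreover have "unitarily_equivalent G H \<rho> K \<sigma>"
    unfolding unitarily_equivalent_def using fu inj by (intro exI[of _ f]) (auto simp: \<sigma>_def)
  ultimately show ?thesis by blast
qed

lemma irreducible_rep_universe:
  fixes G :: "'g monoid" and H :: "'h hilbert_space"
  assumes G: "group G" and irr: "irreducible_rep G H \<rho>"
  shows "\<exists>K \<sigma>. (K, \<sigma>) \<in> irreps G \<and> unitarily_equivalent G H \<rho> K \<sigma>"
proof -
  have rep: "unitary_rep G H \<rho>" and "complex_hilbert H" and nz: "carrier H \<noteq> {\<zero>\<^bsub>H\<^esub>}"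
    using irr by (auto simp: irreducible_rep_def unitary_rep_def)
  interpret H: complex_hilbert H by fact
  obtain v where v: "v \<in> carrier H" "v \<noteq> \<zero>\<^bsub>H\<^esub>" using nz H.M.zero_closed by blast
  have "W = carrier H" if "invariant_subspace G H \<rho> W" "v \<in> W" for W
    using irr that v by (auto simp: irreducible_rep_def)
  from cyclic_rep_universe[OF G rep v(1) this] show ?thesis
    using irreducible_rep_transfer[OF irr] by (auto simp: irreps_def)
qed

lemma irreps_comp:
  assumes "\<phi> \<in> iso G G" "(H, \<rho>) \<in> irreps G"
  shows "(H, \<rho> \<circ> \<phi>) \<in> irreps G"
proof -
  have h: "\<phi> \<in> carrier G \<rightarrow> carrier G"
      "\<And>x y. \<lbrakk>x \<in> carrier G; y \<in> carrier G\<rbrakk> \<Longrightarrow> \<phi> (x \<otimes>\<^bsub>G\<^esub> y) = \<phi> x \<otimes>\<^bsub>G\<^esub> \<phi> y"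
      "\<phi> ` carrier G = carrier G"
    using assms(1) by (auto simp: iso_def hom_def bij_betw_def)
  have "unitary_rep G H (\<rho> \<circ> \<phi>)"
    unfolding unitary_rep_def
  proof (intro conjI ballI)
    have rep: "unitary_rep G H \<rho>"
      using assms(2) by (simp add: irreps_def irreducible_rep_def)
    show "complex_hilbert H" using rep by (simp add: unitary_rep_def)
    fix g assume "g \<in> carrier G"
    then have g: "\<phi> g \<in> carrier G" using h(1) by blast
    show "unitary_operator H H ((\<rho> \<circ> \<phi>) g)" using rep g by (simp add: unitary_rep_def)
    fix k x assume k: "k \<in> carrier G" and x: "x \<in> carrier H"
    have "\<phi> k \<in> carrier G" using h(1) k by blast
    then show "(\<rho> \<circ> \<phi>) (g \<otimes>\<^bsub>G\<^esub> k) x = (\<rho> \<circ> \<phi>) g ((\<rho> \<circ> \<phi>) k x)"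
      using rep g x h(2)[OF \<open>g \<in> carrier G\<close> k] by (simp add: unitary_rep_def)
  qed
  moreover have "invariant_subspace G H \<rho> W" if "invariant_subspace G H (\<rho> \<circ> \<phi>) W" for W
    unfolding invariant_subspace_def
  proof (intro conjI ballI)
    show "closed_subspace H W" using that by (simp add: invariant_subspace_def)
    fix g assume "g \<in> carrier G"
    then obtain g' where "g' \<in> carrier G" "g = \<phi> g'" using h(3) by blast
    then show "\<rho> g ` W \<subseteq> W" using that by (simp add: invariant_subspace_def)
  qed
  ultimately show ?thesis using assms(2) by (auto simp: irreps_def irreducible_rep_def)
qed

lemma dual_map_class:
  assumes "\<phi> \<in> iso G G" "(H, \<rho>) \<in> irreps G"
  shows "dual_map G \<phi> (rep_equiv G `` {(H, \<rho>)}) = rep_equiv G `` {(H, \<rho> \<circ> \<phi>)}"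
proof -
  have "((H, \<rho> \<circ> \<phi>), (K, \<sigma> \<circ> \<phi>)) \<in> rep_equiv G" if "((H, \<rho>), (K, \<sigma>)) \<in> rep_equiv G" for K \<sigma>
  proof -
    have "\<phi> g \<in> carrier G" if "g \<in> carrier G" for g
      using assms(1) that by (auto simp: iso_def hom_def)
    then show ?thesis
      using that irreps_comp[OF assms(1)]
      unfolding rep_equiv_def unitarily_equivalent_def by auto
  qed
  then have "rep_equiv G `` {(K, \<sigma> \<circ> \<phi>)} = rep_equiv G `` {(H, \<rho> \<circ> \<phi>)}"
    if "((H, \<rho>), (K, \<sigma>)) \<in> rep_equiv G" for K \<sigma>
    using equiv_class_eq[OF equiv_rep_equiv] that by metis
  moreover have "((H, \<rho>), (H, \<rho>)) \<in> rep_equiv G"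
    using assms(2) by (simp add: rep_equiv_def unitarily_equivalent_refl)
  ultimately show ?thesis unfolding dual_map_def by fast
qed

lemma equiv_twisted_conjugacy:
  assumes "group G" "\<phi> \<in> iso G G"
  shows "equiv (carrier G) (twisted_conjugacy G \<phi>)"
proof -
  interpret G: group G by fact
  interpret f: group_hom G G \<phi>
    using assms by (simp add: group_hom_def group_hom_axioms_def iso_def)
  show ?thesis
  proof (rule equivI)
    show "twisted_conjugacy G \<phi> \<subseteq> carrier G \<times> carrier G" by (auto simp: twisted_conjugacy_def)
    show "refl_on (carrier G) (twisted_conjugacy G \<phi>)"
      by (auto simp: refl_on_def twisted_conjugacy_def intro!: bexI[of _ "\<one>\<^bsub>G\<^esub>"])
    show "sym (twisted_conjugacy G \<phi>)"
      unfolding sym_def twisted_conjugacy_def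
    proof clarsimp
      fix x g assume "x \<in> carrier G" "g \<in> carrier G"
      then show "\<exists>h\<in>carrier G. x = h \<otimes>\<^bsub>G\<^esub> (g \<otimes>\<^bsub>G\<^esub> x \<otimes>\<^bsub>G\<^esub> inv\<^bsub>G\<^esub> \<phi> g) \<otimes>\<^bsub>G\<^esub> inv\<^bsub>G\<^esub> \<phi> h"
        by (intro bexI[of _ "inv\<^bsub>G\<^esub> g"]) (auto simp: G.m_assoc G.inv_solve_left)
    qed
    show "trans (twisted_conjugacy G \<phi>)"
      unfolding trans_def twisted_conjugacy_def
    proof clarsimp
      fix x g h assume "x \<in> carrier G" "g \<in> carrier G" "h \<in> carrier G"
      then show "\<exists>k\<in>carrier G. h \<otimes>\<^bsub>G\<^esub> (g \<otimes>\<^bsub>G\<^esub> x \<otimes>\<^bsub>G\<^esub> inv\<^bsub>G\<^esub> \<phi> g) \<otimes>\<^bsub>G\<^esub> inv\<^bsub>G\<^esub> \<phi> h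
          = k \<otimes>\<^bsub>G\<^esub> x \<otimes>\<^bsub>G\<^esub> inv\<^bsub>G\<^esub> \<phi> k"
        by (intro bexI[of _ "h \<otimes>\<^bsub>G\<^esub> g"]) (auto simp: G.m_assoc G.inv_mult_group)
    qed
  qed
qed

end

theory Submission
  imports Defs "HOL-Library.Poly_Mapping"
begin

text \<open>
  Let \<open>G = L \<wr> H\<close> be the restricted wreath product of the Heisenberg group \<open>L\<close> modulo 7 and an
  infinite elementary abelian 3-group \<open>H\<close>. The automorphism \<open>\<phi>\<close> inverts \<open>H\<close> and acts on the lamps by
  \<open>\<alpha>(a, b, c) = (2 a, 2 b, 4 c)\<close>. Every \<open>x\<close> has the form \<open>g \<phi>(g)\<inverse>\<close>, so \<open>R(\<phi>) = 1\<close>: on \<open>H\<close> because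
  \<open>H\<close> is 2-divisible, on the base group because \<open>\<alpha>\<^sup>2\<close> has no nontrivial fixed points. Besides the trivial
  representation, \<open>\<phi>\<close> fixes the representation on \<open>\<ell>\<^sup>2(G / H)\<close>, which is irreducible since \<open>H\<close> moves
  every finite set of nontrivial cosets off itself; hence \<open>S(\<phi>) \<ge> 2\<close>.

  The group is locally finite, hence amenable, and solvable of length 3. For every finite set \<open>F\<close> there
  are \<open>a\<close> and \<open>b\<close> that commute with \<open>F\<close> and whose commutator lies outside \<open>F\<close>. For a projection
  \<open>E\<close> in the von Neumann algebra of the regular representation, \<open>E a E b E\<close> and \<open>E b E a E\<close> are then
  close to \<open>a b E\<close> and \<open>b a E\<close> at the trace vector, and these are nearly orthogonal; so \<open>E\<close> cannot be
  abelian.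
\<close>

section \<open>The Hilbert space of square-summable functions\<close>

definition l2 :: "('a \<Rightarrow> complex) hilbert_space" where
  "l2 = \<lparr>carrier = {f. (\<lambda>x. (cmod (f x))\<^sup>2) summable_on UNIV},
    monoid.mult = (\<lambda>f g. f), one = (\<lambda>x. 0), zero = (\<lambda>x. 0), add = (\<lambda>f g x. f x + g x),
    smult = (\<lambda>c f x. c * f x), cinner = (\<lambda>f g. \<Sum>\<^sub>\<infinity>x. f x * cnj (g x))\<rparr>"

lemma l2_simps [simp]:
  "\<zero>\<^bsub>l2\<^esub> = (\<lambda>x. 0)" "f \<oplus>\<^bsub>l2\<^esub> g = (\<lambda>x. f x + g x)" "c \<odot>\<^bsub>l2\<^esub> f = (\<lambda>x. c * f x)"
  "cinner l2 f g = (\<Sum>\<^sub>\<infinity>x. f x * cnj (g x))"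
  by (simp_all add: l2_def)

lemma l2_iff: "f \<in> carrier l2 \<longleftrightarrow> (\<lambda>x. (cmod (f x))\<^sup>2) summable_on UNIV"
  by (simp add: l2_def)

lemma l2_product:
  assumes "f \<in> carrier l2" "g \<in> carrier l2"
  shows "(\<lambda>x. f x * cnj (g x)) summable_on UNIV"
proof -
  have "(\<lambda>x. (cmod (f x))\<^sup>2 + (cmod (g x))\<^sup>2) summable_on UNIV"
    using assms by (intro summable_on_add) (auto simp: l2_iff)
  moreover have "norm (f x * cnj (g x)) \<le> (cmod (f x))\<^sup>2 + (cmod (g x))\<^sup>2" for x
    using sum_squares_bound[of "cmod (f x)" "cmod (g x)"]
      mult_nonneg_nonneg[OF norm_ge_zero norm_ge_zero, of "f x" "g x"]
    unfolding norm_mult complex_mod_cnj by linarith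
  ultimately have "(\<lambda>x. norm (f x * cnj (g x))) summable_on UNIV"
    by (rule summable_on_comparison_test) auto
  then show ?thesis by (rule abs_summable_summable)
qed

lemma l2_zero_mem: "(\<lambda>x. 0) \<in> carrier l2"
  by (simp add: l2_iff)

lemma l2_smult_mem: "f \<in> carrier l2 \<Longrightarrow> (\<lambda>x. c * f x) \<in> carrier l2"
  by (auto simp: l2_iff norm_mult power_mult_distrib intro: summable_on_cmult_right)

lemma l2_add_mem:
  assumes "f \<in> carrier l2" "g \<in> carrier l2"
  shows "(\<lambda>x. f x + g x) \<in> carrier l2"
proof -
  have "(\<lambda>x. 2 * (cmod (f x))\<^sup>2 + 2 * (cmod (g x))\<^sup>2) summable_on UNIV"
    using assms by (intro summable_on_add summable_on_cmult_right) (auto simp: l2_iff)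
  moreover have "(cmod (f x + g x))\<^sup>2 \<le> 2 * (cmod (f x))\<^sup>2 + 2 * (cmod (g x))\<^sup>2" for x
  proof -
    have "(cmod (f x + g x))\<^sup>2 \<le> (cmod (f x) + cmod (g x))\<^sup>2"
      by (intro power_mono norm_triangle_ineq) auto
    then show ?thesis
      using sum_squares_bound[of "cmod (f x)" "cmod (g x)"] by (simp add: power2_sum)
  qed
  ultimately show ?thesis
    unfolding l2_iff by (rule summable_on_comparison_test) auto
qed

lemma cinner_l2_self: "cinner l2 f f = of_real (\<Sum>\<^sub>\<infinity>x. (cmod (f x))\<^sup>2)"
proof -
  let ?g = "\<lambda>x. (cmod (f x))\<^sup>2"
  have "(\<Sum>\<^sub>\<infinity>x. complex_of_real (?g x)) = of_real (\<Sum>\<^sub>\<infinity>x. ?g x)"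
  proof (cases "?g summable_on UNIV")
    case True
    then show ?thesis by (intro infsumI) (simp only: has_sum_of_real_iff has_sum_infsum)
  next
    \<comment> \<open>In the divergent case both sums take the default value 0 of
      \<open>infsum\<close>, so the identity holds for every \<open>f\<close>.\<close>
    case False
    then have "\<not> (\<lambda>x. complex_of_real (?g x)) summable_on UNIV"
      using summable_on_Re by force
    then show ?thesis using False by (simp add: infsum_not_exists)
  qed
  then show ?thesis by (simp flip: complex_norm_square)
qed

lemma hnorm_l2: "hnorm l2 f = sqrt (\<Sum>\<^sub>\<infinity>x. (cmod (f x))\<^sup>2)"
  unfolding hnorm_def cinner_l2_self by simp

lemma module_l2: "Module.module complex_ring (l2 :: ('a \<Rightarrow> complex) hilbert_space)"
proof (rule moduleI)
  show "cring complex_ring"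
    by (rule cring_from_type_algebra)
  show "abelian_group (l2 :: ('a \<Rightarrow> complex) hilbert_space)"
  proof (rule abelian_groupI)
    fix f :: "'a \<Rightarrow> complex" assume "f \<in> carrier l2"
    then show "\<exists>g\<in>carrier l2. g \<oplus>\<^bsub>l2\<^esub> f = \<zero>\<^bsub>l2\<^esub>"
      using l2_smult_mem[of f "-1"] by (intro bexI[of _ "\<lambda>x. - f x"]) auto
  qed (auto simp: l2_add_mem l2_zero_mem add_ac)
qed (simp_all add: l2_smult_mem fun_eq_iff distrib_left distrib_right mult.assoc)

lemma l2_diff:
  assumes "f \<in> carrier l2" "g \<in> carrier l2"
  shows "f \<ominus>\<^bsub>l2\<^esub> g = (\<lambda>x. f x - g x)"
proof -
  interpret Module.module complex_ring l2 by (rule module_l2)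
  have "\<ominus>\<^bsub>l2\<^esub> g = (\<lambda>x. - g x)"
    using assms l2_smult_mem[of g "-1"] by (intro M.minus_equality) auto
  then show ?thesis by (simp add: a_minus_def)
qed

text \<open>A norm-Cauchy sequence is Cauchy at each point. Its Cauchy bounds, read on finite sets
  of coordinates, survive the passage to the pointwise limit and then bound the whole sum.\<close>

lemma l2_complete:
  fixes s :: "nat \<Rightarrow> 'a \<Rightarrow> complex"
  assumes s: "\<And>n. s n \<in> carrier l2"
    and cau: "\<And>e. e > 0 \<Longrightarrow> \<exists>N. \<forall>m\<ge>N. \<forall>n\<ge>N. hnorm l2 (s m \<ominus>\<^bsub>l2\<^esub> s n) < e"
  shows "\<exists>f\<in>carrier l2. (\<lambda>n. hnorm l2 (s n \<ominus>\<^bsub>l2\<^esub> f)) \<longlonglongrightarrow> 0"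
proof -
  have d: "(\<lambda>x. f x - g x) \<in> carrier l2" if "f \<in> carrier l2" "g \<in> carrier l2" for f g :: "'a \<Rightarrow> complex"
    using l2_add_mem[OF that(1) l2_smult_mem[OF that(2), of "-1"]] by simp
  have fin: "(\<Sum>x\<in>F. (cmod (s m x - s n x))\<^sup>2) \<le> (hnorm l2 (s m \<ominus>\<^bsub>l2\<^esub> s n))\<^sup>2" if "finite F" for F m n
  proof -
    have "(\<Sum>x\<in>F. (cmod (s m x - s n x))\<^sup>2) \<le> (\<Sum>\<^sub>\<infinity>x. (cmod (s m x - s n x))\<^sup>2)"
      using d[OF s s, of m n] that by (intro finite_sum_le_infsum) (auto simp: l2_iff)
    also have "\<dots> = (hnorm l2 (s m \<ominus>\<^bsub>l2\<^esub> s n))\<^sup>2"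
      unfolding l2_diff[OF s s] hnorm_l2 by (simp add: infsum_nonneg)
    finally show ?thesis .
  qed
  \<comment> \<open>The bound is uniform in the finite set \<open>F\<close>, so \<open>m\<close> may
    tend to infinity with \<open>F\<close> fixed before \<open>F\<close> grows.\<close>
  have fin_e: "\<exists>N. \<forall>m\<ge>N. \<forall>n\<ge>N. \<forall>F. finite F \<longrightarrow> (\<Sum>x\<in>F. (cmod (s m x - s n x))\<^sup>2) \<le> e\<^sup>2"
    if e: "e > 0" for e
  proof -
    obtain N where N: "\<And>m n. m \<ge> N \<Longrightarrow> n \<ge> N \<Longrightarrow> hnorm l2 (s m \<ominus>\<^bsub>l2\<^esub> s n) < e"
      using cau[OF e] by blast
    have "(\<Sum>x\<in>F. (cmod (s m x - s n x))\<^sup>2) \<le> e\<^sup>2" if "m \<ge> N" "n \<ge> N" "finite F" for m n F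
    proof -
      have "0 \<le> hnorm l2 (s m \<ominus>\<^bsub>l2\<^esub> s n)" unfolding hnorm_l2 by (simp add: infsum_nonneg)
      then have "(hnorm l2 (s m \<ominus>\<^bsub>l2\<^esub> s n))\<^sup>2 \<le> e\<^sup>2"
        using N[OF that(1,2)] by (intro power_mono) auto
      then show ?thesis using fin[OF that(3), of m n] by linarith
    qed
    then show ?thesis by blast
  qed
  have "Cauchy (\<lambda>n. s n x)" for x
  proof (rule metric_CauchyI)
    fix e :: real assume e: "e > 0"
    obtain N where N: "\<forall>m\<ge>N. \<forall>n\<ge>N. \<forall>F. finite F \<longrightarrow>
        (\<Sum>x\<in>F. (cmod (s m x - s n x))\<^sup>2) \<le> (e/2)\<^sup>2"
      using fin_e[OF half_gt_zero[OF e]] ..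
    have "dist (s m x) (s n x) < e" if "m \<ge> N" "n \<ge> N" for m n
    proof -
      have "cmod (s m x - s n x) \<le> e/2"
      proof (rule power2_le_imp_le)
        have "(\<Sum>y\<in>{x}. (cmod (s m y - s n y))\<^sup>2) \<le> (e/2)\<^sup>2" using N that by blast
        then show "(cmod (s m x - s n x))\<^sup>2 \<le> (e/2)\<^sup>2" by simp
      qed (use e in simp)
      then show ?thesis using e by (simp add: dist_norm)
    qed
    then show "\<exists>M. \<forall>m\<ge>M. \<forall>n\<ge>M. dist (s m x) (s n x) < e" by blast
  qed
  then have "\<exists>l. (\<lambda>n. s n x) \<longlonglongrightarrow> l" for x
    using Cauchy_convergent_iff convergent_def by blast
  then obtain f where f: "\<And>x. (\<lambda>n. s n x) \<longlonglongrightarrow> f x" by metis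
  have lim: "\<exists>N. \<forall>n\<ge>N. (\<lambda>x. s n x - f x) \<in> carrier l2 \<and> hnorm l2 (\<lambda>x. s n x - f x) \<le> e"
    if e: "e > 0" for e
  proof -
    obtain N where N: "\<forall>m\<ge>N. \<forall>n\<ge>N. \<forall>F. finite F \<longrightarrow>
        (\<Sum>x\<in>F. (cmod (s m x - s n x))\<^sup>2) \<le> e\<^sup>2"
      using fin_e[OF e] ..
    have "(\<lambda>x. s n x - f x) \<in> carrier l2 \<and> hnorm l2 (\<lambda>x. s n x - f x) \<le> e" if n: "n \<ge> N" for n
    proof -
      have b: "(\<Sum>x\<in>F. (cmod (s n x - f x))\<^sup>2) \<le> e\<^sup>2" if F: "finite F" for F
      proof (rule tendsto_upperbound)
        show "(\<lambda>m. \<Sum>x\<in>F. (cmod (s n x - s m x))\<^sup>2) \<longlonglongrightarrow> (\<Sum>x\<in>F. (cmod (s n x - f x))\<^sup>2)"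
          by (intro tendsto_intros f)
        show "\<forall>\<^sub>F m in sequentially. (\<Sum>x\<in>F. (cmod (s n x - s m x))\<^sup>2) \<le> e\<^sup>2"
          by (rule eventually_mono[OF eventually_ge_at_top[of N]]) (use N n F in blast)
      qed simp
      have "(\<lambda>x. (cmod (s n x - f x))\<^sup>2) summable_on UNIV"
        by (intro nonneg_bdd_above_summable_on bdd_aboveI[of _ "e\<^sup>2"]) (auto simp: b)
      moreover from this have "(\<Sum>\<^sub>\<infinity>x. (cmod (s n x - f x))\<^sup>2) \<le> e\<^sup>2"
        by (rule infsum_le_finite_sums) (auto simp: b)
      ultimately show ?thesis
        using real_sqrt_le_mono[of "\<Sum>\<^sub>\<infinity>x. (cmod (s n x - f x))\<^sup>2" "e\<^sup>2"] e
        unfolding l2_iff hnorm_l2 by simp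
    qed
    then show ?thesis by blast
  qed
  \<comment> \<open>\<open>f\<close> is \<open>s n\<close> minus the square-summable difference
    \<open>s n - f\<close>.\<close>
  have fl2: "f \<in> carrier l2"
  proof -
    obtain n where "(\<lambda>x. s n x - f x) \<in> carrier l2" using lim[of 1] by auto
    from d[OF s[of n] this] show ?thesis by simp
  qed
  moreover have "(\<lambda>n. hnorm l2 (s n \<ominus>\<^bsub>l2\<^esub> f)) \<longlonglongrightarrow> 0"
  proof (rule metric_LIMSEQ_I)
    fix e :: real assume e: "e > 0"
    obtain N where N: "\<And>n. n \<ge> N \<Longrightarrow> hnorm l2 (\<lambda>x. s n x - f x) \<le> e/2"
      using lim[OF half_gt_zero[OF e]] by blast
    have "dist (hnorm l2 (s n \<ominus>\<^bsub>l2\<^esub> f)) 0 < e" if "n \<ge> N" for n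
    proof -
      have "0 \<le> hnorm l2 (\<lambda>x. s n x - f x)" unfolding hnorm_l2 by (simp add: infsum_nonneg)
      then show ?thesis using N[OF that] e unfolding l2_diff[OF s fl2] by simp
    qed
    then show "\<exists>N. \<forall>n\<ge>N. dist (hnorm l2 (s n \<ominus>\<^bsub>l2\<^esub> f)) 0 < e" by blast
  qed
  ultimately show ?thesis by blast
qed

lemma hilbert_l2: "complex_hilbert (l2 :: ('a \<Rightarrow> complex) hilbert_space)"
proof (intro complex_hilbert.intro complex_hilbert_axioms.intro)
  show "Module.module complex_ring (l2 :: ('a \<Rightarrow> complex) hilbert_space)" by (rule module_l2)
  fix f g h :: "'a \<Rightarrow> complex" and c
  assume f: "f \<in> carrier l2" and g: "g \<in> carrier l2"
  show "cinner l2 (c \<odot>\<^bsub>l2\<^esub> f) g = c * cinner l2 f g"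
    by (simp add: mult.assoc infsum_cmult_right')
  show "cinner l2 g f = cnj (cinner l2 f g)"
    by (simp add: mult.commute flip: infsum_cnj)
  show "0 \<le> Re (cinner l2 f f)"
    unfolding cinner_l2_self by (simp add: infsum_nonneg)
  show "f = \<zero>\<^bsub>l2\<^esub>" if z: "cinner l2 f f = 0"
  proof -
    have "hnorm l2 f = 0" using z by (simp add: hnorm_def)
    then have "(\<Sum>\<^sub>\<infinity>x. (cmod (f x))\<^sup>2) = 0" by (simp add: hnorm_l2)
    then have "(cmod (f x))\<^sup>2 = 0" for x
      using f by (intro nonneg_infsum_le_0D[of "\<lambda>x. (cmod (f x))\<^sup>2" UNIV]) (auto simp: l2_iff)
    then show ?thesis by auto
  qed
  assume h: "h \<in> carrier l2"
  show "cinner l2 (f \<oplus>\<^bsub>l2\<^esub> g) h = cinner l2 f h + cinner l2 g h"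
    using infsum_add[OF l2_product[OF f h] l2_product[OF g h]] by (simp add: distrib_right)
qed (fact l2_complete)

section \<open>Norm identities and inequalities in an abstract Hilbert space\<close>

context complex_hilbert begin

lemma hnorm_nonneg [simp]: "x \<in> carrier H \<Longrightarrow> 0 \<le> hnorm H x"
  by (simp add: hnorm_def cinner_nonneg)

lemma hnorm_square: "x \<in> carrier H \<Longrightarrow> (hnorm H x)\<^sup>2 = Re (cinner H x x)"
  by (simp add: hnorm_def cinner_nonneg)

lemma hnorm_smult:
  assumes x: "x \<in> carrier H"
  shows "hnorm H (c \<odot> x) = cmod c * hnorm H x"
proof (rule power2_eq_imp_eq)
  have "cinner H (c \<odot> x) (c \<odot> x) = (c * cnj c) * cinner H x x"
    using x by (simp add: cinner_smult cinner_smult_right)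
  also have "c * cnj c = of_real ((cmod c)\<^sup>2)"
    by (rule complex_norm_square[symmetric])
  finally show "(hnorm H (c \<odot> x))\<^sup>2 = (cmod c * hnorm H x)\<^sup>2"
    using x by (simp add: hnorm_square power_mult_distrib)
qed (use x in auto)

lemma hnorm_add_square:
  assumes "x \<in> carrier H" "y \<in> carrier H"
  shows "(hnorm H (x \<oplus> y))\<^sup>2 = (hnorm H x)\<^sup>2 + (hnorm H y)\<^sup>2 + 2 * Re (cinner H x y)"
  using assms cinner_commute[of x y] by (simp add: hnorm_square cinner_add cinner_add_right)

lemma hnorm_triangle:
  assumes "x \<in> carrier H" "y \<in> carrier H"
  shows "hnorm H (x \<oplus> y) \<le> hnorm H x + hnorm H y"
proof (rule power2_le_imp_le)
  have "Re (cinner H x y) \<le> hnorm H x * hnorm H y"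
    using cauchy_schwarz[OF assms] complex_Re_le_cmod[of "cinner H x y"] by linarith
  then show "(hnorm H (x \<oplus> y))\<^sup>2 \<le> (hnorm H x + hnorm H y)\<^sup>2"
    using assms by (simp add: hnorm_add_square power2_sum)
qed (use assms in simp)

lemma hnorm_diff_triangle:
  assumes "x \<in> carrier H" "y \<in> carrier H" "z \<in> carrier H"
  shows "hnorm H (x \<ominus> z) \<le> hnorm H (x \<ominus> y) + hnorm H (y \<ominus> z)"
proof -
  have "(x \<ominus> y) \<oplus> (y \<ominus> z) = x \<oplus> (\<ominus> y \<oplus> y) \<oplus> \<ominus> z"
    using assms by (simp add: a_minus_def M.a_assoc)
  also have "\<dots> = x \<ominus> z" using assms by (simp add: M.l_neg a_minus_def)
  finally show ?thesis using hnorm_triangle[of "x \<ominus> y" "y \<ominus> z"] assms by simp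
qed

lemma hnorm_diff_commute:
  assumes "x \<in> carrier H" "y \<in> carrier H"
  shows "hnorm H (x \<ominus> y) = hnorm H (y \<ominus> x)"
proof -
  have "cinner H (x \<ominus> y) (x \<ominus> y) = cinner H (y \<ominus> x) (y \<ominus> x)"
    using assms
    by (simp add: diff_eq cinner_add cinner_add_right cinner_smult cinner_smult_right)
  then show ?thesis by (simp add: hnorm_def)
qed

end

interpretation l2: complex_hilbert l2
  by (rule hilbert_l2)

section \<open>Finitely supported functions, orthogonality and reindexing\<close>

definition cutoff :: "'a set \<Rightarrow> ('a \<Rightarrow> complex) \<Rightarrow> 'a \<Rightarrow> complex"
  where "cutoff F f = (\<lambda>x. if x \<in> F then f x else 0)"

definition dirac :: "'a \<Rightarrow> 'a \<Rightarrow> complex"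
  where "dirac p = (\<lambda>x. if x = p then 1 else 0)"

lemma l2_diff_mem: "f \<in> carrier l2 \<Longrightarrow> g \<in> carrier l2 \<Longrightarrow> (\<lambda>x. f x - g x) \<in> carrier l2"
  using l2.M.minus_closed[of f g] by (simp add: l2_diff)

lemma cutoff_mem: "finite F \<Longrightarrow> cutoff F f \<in> carrier l2"
  unfolding l2_iff
  by (rule summable_on_cong_neutral[THEN iffD1, OF _ _ _ summable_on_finite[of F "\<lambda>x. (cmod (cutoff F f x))\<^sup>2"]])
    (auto simp: cutoff_def)

lemma dirac_mem [simp]: "dirac p \<in> carrier l2"
  using cutoff_mem[of "{p}" "\<lambda>x. 1"] by (simp add: cutoff_def dirac_def)

text \<open>Finitely supported functions are dense: the squared error is the tail of a convergent
  series.\<close>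

lemma cutoff_approx:
  assumes f: "f \<in> carrier l2" and e: "e > 0"
  shows "\<exists>F. finite F \<and> hnorm l2 (\<lambda>x. f x - cutoff F f x) < e"
proof -
  let ?g = "\<lambda>x. (cmod (f x))\<^sup>2"
  have g: "?g summable_on UNIV" using f by (simp add: l2_iff)
  have "(sum ?g \<longlongrightarrow> infsum ?g UNIV) (finite_subsets_at_top UNIV)"
    using has_sum_infsum[OF g] by (simp add: has_sum_def)
  then have "\<forall>\<^sub>F F in finite_subsets_at_top UNIV. dist (sum ?g F) (infsum ?g UNIV) < e\<^sup>2"
    using e by (simp add: tendsto_iff)
  then obtain F where F: "finite F" "dist (sum ?g F) (infsum ?g UNIV) < e\<^sup>2"
    unfolding eventually_finite_subsets_at_top by blast
  have "(\<Sum>\<^sub>\<infinity>x. (cmod (f x - cutoff F f x))\<^sup>2) = infsum ?g (UNIV - F)"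
    by (rule infsum_cong_neutral) (auto simp: cutoff_def)
  also have "\<dots> = infsum ?g UNIV - sum ?g F"
    using F(1) g by (subst infsum_Diff) auto
  also have "\<dots> < e\<^sup>2" using F(2) by (simp add: dist_real_def)
  finally have "sqrt (\<Sum>\<^sub>\<infinity>x. (cmod (f x - cutoff F f x))\<^sup>2) < sqrt (e\<^sup>2)"
    by (rule real_sqrt_less_mono)
  then show ?thesis using F(1) e unfolding hnorm_l2 by auto
qed

lemma hnorm_cutoff_le:
  assumes "f \<in> carrier l2" "finite F"
  shows "hnorm l2 (cutoff F f) \<le> hnorm l2 f"
  unfolding hnorm_l2
proof (intro real_sqrt_le_mono infsum_mono)
  show "(\<lambda>x. (cmod (cutoff F f x))\<^sup>2) summable_on UNIV"
    using cutoff_mem[OF assms(2)] by (simp add: l2_iff)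
qed (use assms(1) in \<open>auto simp: l2_iff cutoff_def\<close>)

lemma cinner_l2_disjoint:
  "(\<And>x. f x = 0 \<or> g x = 0) \<Longrightarrow> cinner l2 f g = 0"
  unfolding l2_simps by (rule infsum_0) (metis complex_cnj_zero mult_eq_0_iff)

lemma l2_reindex_mem:
  assumes "bij q" "f \<in> carrier l2"
  shows "f \<circ> q \<in> carrier l2"
  using summable_on_reindex_bij_betw[OF assms(1), of "\<lambda>x. (cmod (f x))\<^sup>2"] assms(2)
  by (simp add: l2_iff)

lemma unitary_reindex:
  assumes p: "bij p"
  shows "unitary_operator l2 l2 (\<lambda>f. f \<circ> p)"
proof -
  have "f \<in> (\<lambda>f. f \<circ> p) ` carrier l2" if "f \<in> carrier l2" for f
    using l2_reindex_mem[OF bij_imp_bij_inv[OF p] that] p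
    by (intro image_eqI[of _ _ "f \<circ> inv_into UNIV p"]) (auto simp: fun_eq_iff bij_is_inj)
  moreover have "cinner l2 (f \<circ> p) (g \<circ> p) = cinner l2 f g" for f g
    using infsum_reindex_bij_betw[OF p, of "\<lambda>x. f x * cnj (g x)"] by simp
  ultimately show ?thesis
    unfolding unitary_operator_def linear_operator_def
    using l2_reindex_mem[OF p] by (auto simp: fun_eq_iff)
qed

section \<open>Permutation representations\<close>

text \<open>Inverting \<open>g\<close> makes this a homomorphism for a left action, under which
  \<open>dirac x\<close> moves to \<open>dirac (act g x)\<close>.\<close>

definition perm_rep ::
    "'g monoid \<Rightarrow> ('g \<Rightarrow> 'x \<Rightarrow> 'x) \<Rightarrow> 'g \<Rightarrow> ('x \<Rightarrow> complex) \<Rightarrow> ('x \<Rightarrow> complex)"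
  where "perm_rep G act g f = (\<lambda>x. f (act (inv\<^bsub>G\<^esub> g) x))"

locale permutation_action = group G for G :: "'g monoid" (structure) +
  fixes act :: "'g \<Rightarrow> 'x \<Rightarrow> 'x"
  assumes act_one [simp]: "act \<one> x = x"
    and act_mult: "\<lbrakk>g \<in> carrier G; h \<in> carrier G\<rbrakk> \<Longrightarrow> act (g \<otimes> h) x = act g (act h x)"
begin

lemma act_inv [simp]: "g \<in> carrier G \<Longrightarrow> act (inv g) (act g x) = x"
  "g \<in> carrier G \<Longrightarrow> act g (act (inv g) x) = x"
  by (simp_all flip: act_mult)

lemma act_inv_eq_iff: "g \<in> carrier G \<Longrightarrow> act (inv g) x = y \<longleftrightarrow> x = act g y"
  by auto

lemma bij_act: "g \<in> carrier G \<Longrightarrow> bij (act g)"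
  by (rule bijI') (metis act_inv)+

lemma unitary_perm_rep: "g \<in> carrier G \<Longrightarrow> unitary_operator l2 l2 (perm_rep G act g)"
  using unitary_reindex[OF bij_act[OF inv_closed], of g] by (simp add: perm_rep_def[abs_def] comp_def)

lemma unitary_rep_perm_rep: "unitary_rep G l2 (perm_rep G act)"
  unfolding unitary_rep_def
  by (auto simp: hilbert_l2 unitary_perm_rep inv_mult_group act_mult)
    (simp add: perm_rep_def inv_mult_group act_mult)

lemma perm_rep_dirac: "g \<in> carrier G \<Longrightarrow> perm_rep G act g (dirac x) = dirac (act g x)"
  by (auto simp: perm_rep_def dirac_def act_inv_eq_iff)

end

text \<open>A form of Mackey's irreducibility criterion: \<open>mixing\<close> forces the stabilizer
  of \<open>p\<close> to have only infinite orbits away from \<open>p\<close>. A one-point set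
  qualifies trivially, which lets the trivial representation be treated in the same way.\<close>

locale mixing_action = permutation_action +
  fixes p
  assumes transitive: "\<exists>g\<in>carrier G. act g p = x"
    and mixing: "\<lbrakk>finite S; p \<notin> S\<rbrakk> \<Longrightarrow> \<exists>g\<in>carrier G. act g p = p \<and> act g ` S \<inter> S = {}"
begin

text \<open>For finitely supported \<open>r\<close> the stabilizer of \<open>p\<close> can move the
  support off itself, making the inner product 0; density gives the general case up to
  \<open>e\<close>.\<close>

lemma weakly_mixing:
  assumes r: "r \<in> carrier l2" "r p = 0" and e: "e > 0"
  shows "\<exists>g\<in>carrier G. act g p = p \<and> cmod (cinner l2 r (perm_rep G act g r)) \<le> e"
proof -
  \<comment> \<open>The error made by replacing \<open>r\<close> with its cutoff is at most
    \<open>2 * d * hnorm l2 r\<close>; the added 1 excludes a zero denominator.\<close>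
  define d where "d = e / (2 * (hnorm l2 r + 1))"
  have n: "0 \<le> hnorm l2 r" using r by simp
  have d: "d > 0" using e n by (simp add: d_def)
  obtain F where F: "finite F" "hnorm l2 (\<lambda>x. r x - cutoff F r x) < d"
    using cutoff_approx[OF r(1) d] by blast
  define s where "s = cutoff F r"
  have s: "s \<in> carrier l2" "hnorm l2 s \<le> hnorm l2 r"
    unfolding s_def using F cutoff_mem hnorm_cutoff_le r by auto
  have rs: "hnorm l2 (r \<ominus>\<^bsub>l2\<^esub> s) \<le> d" using F(2) r(1) s(1) by (simp add: l2_diff s_def)
  \<comment> \<open>\<open>mixing\<close> concerns sets without \<open>p\<close>; since
    \<open>r p = 0\<close>, removing \<open>p\<close> from \<open>F\<close> loses no part of the
    support of \<open>s\<close>.\<close>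
  obtain g where g: "g \<in> carrier G" "act g p = p" "act g ` (F - {p}) \<inter> (F - {p}) = {}"
    using mixing[of "F - {p}"] F(1) by auto
  let ?L = "perm_rep G act g"
  note U = unitary_perm_rep[OF g(1)] and u = unitaryD[OF unitary_perm_rep[OF g(1)]]
  have "cinner l2 s (?L s) = 0"
  proof (rule cinner_l2_disjoint)
    fix x show "s x = 0 \<or> ?L s x = 0"
    proof (rule ccontr)
      assume "\<not> ?thesis"
      then have "x \<in> F" "r x \<noteq> 0" "act (inv g) x \<in> F" "r (act (inv g) x) \<noteq> 0"
        by (auto simp: s_def cutoff_def perm_rep_def split: if_splits)
      then have "x \<in> F - {p}" "act (inv g) x \<in> F - {p}" using r(2) by auto
      moreover have "x = act g (act (inv g) x)" using g(1) by simp
      ultimately show False using g(3) by blast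
    qed
  qed
  moreover have "?L (r \<ominus>\<^bsub>l2\<^esub> s) = ?L r \<ominus>\<^bsub>l2\<^esub> ?L s"
    using unitary_diff[OF hilbert_l2 hilbert_l2 U] r s by blast
  \<comment> \<open>Replace \<open>r\<close> by \<open>s\<close> in one argument at a time; what
    remains is the vanishing term \<open>cinner l2 s (?L s)\<close>.\<close>
  ultimately have "cinner l2 r (?L r) = cinner l2 (r \<ominus>\<^bsub>l2\<^esub> s) (?L r) + cinner l2 s (?L (r \<ominus>\<^bsub>l2\<^esub> s))"
    using r s u(1) l2.cinner_commute[of s "?L r \<ominus>\<^bsub>l2\<^esub> ?L s"] l2.cinner_commute[of s "?L r"]
      l2.cinner_commute[of s "?L s"]
    by (simp add: l2.cinner_diff del: l2_simps)
  then have "cmod (cinner l2 r (?L r))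
      \<le> cmod (cinner l2 (r \<ominus>\<^bsub>l2\<^esub> s) (?L r)) + cmod (cinner l2 s (?L (r \<ominus>\<^bsub>l2\<^esub> s)))"
    by (metis norm_triangle_ineq)
  also have "\<dots> \<le> hnorm l2 (r \<ominus>\<^bsub>l2\<^esub> s) * hnorm l2 r + hnorm l2 s * hnorm l2 (r \<ominus>\<^bsub>l2\<^esub> s)"
    using l2.cauchy_schwarz[of "r \<ominus>\<^bsub>l2\<^esub> s" "?L r"] l2.cauchy_schwarz[of s "?L (r \<ominus>\<^bsub>l2\<^esub> s)"] r s u(1,6)
    by (simp del: l2_simps)
  also have "\<dots> \<le> d * hnorm l2 r + hnorm l2 r * d"
    using rs s n r d by (intro add_mono mult_mono) auto
  also have "\<dots> \<le> e"
  proof -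
    have "2 * d * hnorm l2 r \<le> 2 * d * (hnorm l2 r + 1)" using d by simp
    also have "\<dots> = e" using n by (simp add: d_def field_simps)
    finally show ?thesis by (simp add: algebra_simps)
  qed
  finally show ?thesis using g by blast
qed

text \<open>The mean of \<open>f\<close> and a translate almost orthogonal to it away from \<open>p\<close> stays in \<open>W\<close> and nearly
  halves the squared distance to \<open>dirac p\<close>; iterating avoids orthogonal projections.\<close>

lemma dirac_in_closed_invariant:
  assumes W: "invariant_subspace G l2 (perm_rep G act) W" and f: "f \<in> W" "f p = 1"
  shows "dirac p \<in> W"
proof -
  have sub: "submodule W complex_ring l2"
    and cl: "\<And>s x. \<lbrakk>\<And>n::nat. s n \<in> W; x \<in> carrier l2; (\<lambda>n. hnorm l2 (s n \<ominus>\<^bsub>l2\<^esub> x)) \<longlonglongrightarrow> 0\<rbrakk> \<Longrightarrow> x \<in> W"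
    using W unfolding invariant_subspace_def closed_subspace_def by blast+
  have inv: "perm_rep G act g f \<in> W" if "f \<in> W" "g \<in> carrier G" for f g
    using W that unfolding invariant_subspace_def by blast
  note w = l2.submoduleE[OF sub]
  let ?d = "\<lambda>f. (hnorm l2 (f \<ominus>\<^bsub>l2\<^esub> dirac p))\<^sup>2"
  have step: "\<exists>f'\<in>W. f' p = 1 \<and> ?d f' \<le> 3/4 * ?d f" if f: "f \<in> W" "f p = 1" for f
  proof (cases "?d f = 0")
    case True
    then show ?thesis using f by (intro bexI[of _ f]) auto
  next
    case False
    define r where "r = f \<ominus>\<^bsub>l2\<^esub> dirac p"
    have fl: "f \<in> carrier l2" using f w(1) by blast
    have r: "r \<in> carrier l2" "r p = 0" 
      using fl f(2) by (simp_all add: r_def l2_diff l2_diff_mem) (simp add: dirac_def)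
    \<comment> \<open>With half the squared distance as tolerance, the mean has squared distance at
      most (1 + 1 + 2 * 1/2) / 4 = 3/4 of the old one. The tolerance is positive because the zero
      case was split off.\<close>
    have e: "?d f / 2 > 0" using False by simp
    from weakly_mixing[OF r e] obtain g where g: "g \<in> carrier G" "act g p = p"
        "cmod (cinner l2 r (perm_rep G act g r)) \<le> ?d f / 2" by blast
    let ?L = "perm_rep G act g"
    note U = unitary_perm_rep[OF g(1)] and u = unitaryD[OF unitary_perm_rep[OF g(1)]]
    define f' where "f' = (1/2) \<odot>\<^bsub>l2\<^esub> (f \<oplus>\<^bsub>l2\<^esub> ?L f)"
    have "f' \<in> W" unfolding f'_def using w(4)[OF _ w(5)[OF f(1) inv[OF f(1) g(1)]]] by (simp del: l2_simps)
    moreover have "?L f p = f p" using g act_inv_eq_iff[of g p p] by (simp add: perm_rep_def)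
    then have "f' p = 1" using f(2) by (simp add: f'_def)
    moreover have "?L r = ?L f \<ominus>\<^bsub>l2\<^esub> dirac p"
      using unitary_diff[OF hilbert_l2 hilbert_l2 U fl dirac_mem] perm_rep_dirac[OF g(1)] g(2)
      by (simp add: r_def)
    then have "f' \<ominus>\<^bsub>l2\<^esub> dirac p = (1/2) \<odot>\<^bsub>l2\<^esub> (r \<oplus>\<^bsub>l2\<^esub> ?L r)"
      using fl u(1)[OF fl] \<open>f' \<in> W\<close> w(1)
      by (auto simp: l2_diff r_def f'_def fun_eq_iff field_simps)
    then have "hnorm l2 (f' \<ominus>\<^bsub>l2\<^esub> dirac p) = hnorm l2 (r \<oplus>\<^bsub>l2\<^esub> ?L r) / 2"
      using r u(1) l2.hnorm_smult[of "r \<oplus>\<^bsub>l2\<^esub> ?L r" "1/2"] by (simp del: l2_simps)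
    then have "?d f' = (hnorm l2 (r \<oplus>\<^bsub>l2\<^esub> ?L r))\<^sup>2 / 4" by (simp only: power_divide) simp
    moreover have "(hnorm l2 (r \<oplus>\<^bsub>l2\<^esub> ?L r))\<^sup>2 \<le> ?d f + ?d f + 2 * (?d f / 2)"
      using g(3) complex_Re_le_cmod[of "cinner l2 r (?L r)"]
      unfolding l2.hnorm_add_square[OF r(1) u(1)[OF r(1)]] u(6)[OF r(1)] r_def[symmetric] by linarith
    ultimately show ?thesis by (intro bexI[of _ f']) auto
  qed
  have "\<exists>f'\<in>W. f' p = 1 \<and> ?d f' \<le> (3/4)^n * ?d f" for n
  proof (induction n)
    case 0
    then show ?case using f by auto
  next
    case (Suc n)
    then obtain f' where "f' \<in> W" "f' p = 1" "?d f' \<le> (3/4)^n * ?d f" by blast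
    moreover from step[OF this(1,2)] obtain f'' where "f'' \<in> W" "f'' p = 1" "?d f'' \<le> 3/4 * ?d f'"
      by blast
    ultimately show ?case by (intro bexI[of _ f'']) auto
  qed
  then obtain s where s: "\<And>n. s n \<in> W" "\<And>n. ?d (s n) \<le> (3/4)^n * ?d f" by metis
  have lim: "(\<lambda>n. (3/4)^n * ?d f) \<longlonglongrightarrow> 0"
    by (intro tendsto_mult_left_zero LIMSEQ_realpow_zero) auto
  have "(\<lambda>n. ?d (s n)) \<longlonglongrightarrow> 0"
    by (intro tendsto_sandwich[OF always_eventually always_eventually tendsto_const lim])
      (simp_all only: s zero_le_power2 simp_thms)
  then have "(\<lambda>n. sqrt (?d (s n))) \<longlonglongrightarrow> sqrt 0" by (rule tendsto_real_sqrt)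
  moreover have "sqrt (?d (s n)) = hnorm l2 (s n \<ominus>\<^bsub>l2\<^esub> dirac p)" for n
    using s(1)[of n] w(1) by (intro real_sqrt_unique) auto
  ultimately show ?thesis using cl[of s "dirac p"] s(1) by simp
qed

text \<open>A nonzero vector of \<open>W\<close>, translated and rescaled, takes the value 1 at
  \<open>p\<close>, so \<open>W\<close> contains \<open>dirac p\<close>. Transitivity gives every
  \<open>dirac y\<close>, and density together with closedness gives the whole space.\<close>

lemma irreducible_perm_rep: "irreducible_rep G l2 (perm_rep G act)"
  unfolding irreducible_rep_def
proof (intro conjI allI impI)
  show "unitary_rep G l2 (perm_rep G act)" by (rule unitary_rep_perm_rep)
  have "dirac p p \<noteq> (\<lambda>x. 0) p" by (simp add: dirac_def)
  then show "carrier l2 \<noteq> {\<zero>\<^bsub>l2 :: ('b \<Rightarrow> complex) hilbert_space\<^esub>}" by (metis dirac_mem l2_simps(1) singletonD)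
  fix W assume W: "invariant_subspace G l2 (perm_rep G act) W"
  then have sub: "submodule W complex_ring l2"
    and cl: "\<And>s x. \<lbrakk>\<And>n::nat. s n \<in> W; x \<in> carrier l2; (\<lambda>n. hnorm l2 (s n \<ominus>\<^bsub>l2\<^esub> x)) \<longlonglongrightarrow> 0\<rbrakk> \<Longrightarrow> x \<in> W"
    unfolding invariant_subspace_def closed_subspace_def by blast+
  have inv: "perm_rep G act g f \<in> W" if "f \<in> W" "g \<in> carrier G" for f g
    using W that unfolding invariant_subspace_def by blast
  note w = l2.submoduleE[OF sub]
  have W0: "\<zero>\<^bsub>l2\<^esub> \<in> W" using submodule.axioms(1)[OF sub] subgroup.one_closed by fastforce
  show "W = {\<zero>\<^bsub>l2\<^esub>} \<or> W = carrier l2"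
  proof (rule disjCI)
    assume "W \<noteq> carrier l2"
    have "f x = 0" if f: "f \<in> W" for f x
    proof (rule ccontr)
      assume nz: "f x \<noteq> 0"
      obtain g where g: "g \<in> carrier G" "act g p = x" using transitive by blast
      define f' where "f' = (1 / f x) \<odot>\<^bsub>l2\<^esub> perm_rep G act (inv g) f"
      have "f' \<in> W" unfolding f'_def using w(4)[OF _ inv[OF f inv_closed[OF g(1)]]] by (simp del: l2_simps)
      moreover have "f' p = 1" using g nz by (simp add: f'_def perm_rep_def)
      ultimately have "dirac p \<in> W" using dirac_in_closed_invariant[OF W] by blast
      then have d: "dirac y \<in> W" for y
        using transitive[of y] inv perm_rep_dirac by metis
      have c: "cutoff F k \<in> W" if "finite F" for F k
        using that
      proof (induction F rule: finite_induct)
        case empty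
        then show ?case using W0 by (simp add: cutoff_def)
      next
        case (insert y F)
        have "cutoff (insert y F) k = (k y \<odot>\<^bsub>l2\<^esub> dirac y) \<oplus>\<^bsub>l2\<^esub> cutoff F k"
          using insert.hyps by (auto simp: cutoff_def dirac_def)
        then show ?case using w(4,5) d insert.IH by simp
      qed
      have "k \<in> W" if k: "k \<in> carrier l2" for k
      proof -
        have "\<exists>F. finite F \<and> hnorm l2 (\<lambda>x. k x - cutoff F k x) < inverse (real (Suc n))" for n
          using cutoff_approx[OF k] by simp
        then obtain F where F: "\<And>n. finite (F n)"
            "\<And>n. hnorm l2 (\<lambda>x. k x - cutoff (F n) k x) < inverse (real (Suc n))" by metis
        have eq: "hnorm l2 (cutoff (F n) k \<ominus>\<^bsub>l2\<^esub> k) = hnorm l2 (\<lambda>x. k x - cutoff (F n) k x)" for n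
          unfolding l2_diff[OF cutoff_mem[OF F(1)] k] hnorm_l2 by (simp add: norm_minus_commute)
        have "(\<lambda>n. hnorm l2 (cutoff (F n) k \<ominus>\<^bsub>l2\<^esub> k)) \<longlonglongrightarrow> 0"
        proof (rule tendsto_sandwich[OF _ _ tendsto_const LIMSEQ_inverse_real_of_nat])
          show "\<forall>\<^sub>F n in sequentially. hnorm l2 (cutoff (F n) k \<ominus>\<^bsub>l2\<^esub> k) \<le> inverse (real (Suc n))"
            using F(2) by (simp add: eq less_imp_le)
        qed (use F(1) k cutoff_mem in \<open>auto intro!: always_eventually l2.hnorm_nonneg l2.M.minus_closed\<close>)
        then show ?thesis using cl[of "\<lambda>n. cutoff (F n) k" k] c F(1) k by blast
      qed
      then show False using \<open>W \<noteq> carrier l2\<close> w(1) by blast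
    qed
    then have "f = \<zero>\<^bsub>l2\<^esub>" if "f \<in> W" for f using that by auto
    then show "W = {\<zero>\<^bsub>l2\<^esub>}" using W0 by blast
  qed
qed

end

section \<open>Groups that are not of type I\<close>

lemma cinner_dirac: "cinner l2 f (dirac x) = f x"
proof -
  have "cinner l2 f (dirac x) = (\<Sum>\<^sub>\<infinity>y\<in>{x}. f y)"
    unfolding l2_simps by (rule infsum_cong_neutral) (auto simp: dirac_def)
  then show ?thesis by simp
qed

text \<open>For a self-adjoint idempotent, \<open>cinner H (E x) (E x) = cinner H x (E x)\<close>;
  after Cauchy-Schwarz one factor cancels.\<close>

lemma projection_contractive:
  assumes H: "complex_hilbert H" and E: "E \<in> bounded_operators H" "nonzero_projection H M E"
    and x: "x \<in> carrier H"
  shows "hnorm H (E x) \<le> hnorm H x"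
proof -
  interpret complex_hilbert H by fact
  have Ex: "E x \<in> carrier H"
    using E(1) x by (auto simp: bounded_operators_def linear_operator_def)
  have "cinner H (E x) (E x) = cinner H x (E x)"
    using E(2) x Ex by (simp add: nonzero_projection_def)
  then have "(hnorm H (E x))\<^sup>2 \<le> hnorm H x * hnorm H (E x)"
    using cauchy_schwarz[OF x Ex] complex_Re_le_cmod[of "cinner H x (E x)"]
    by (simp add: hnorm_square Ex)
  then show ?thesis
    using x Ex hnorm_nonneg[OF Ex] by (cases "hnorm H (E x) = 0") (auto simp: power2_eq_square)
qed

lemma linear_operator_diff:
  assumes "complex_hilbert H" "complex_hilbert K" "linear_operator H K T"
    and "x \<in> carrier H" "y \<in> carrier H"
  shows "T (x \<ominus>\<^bsub>H\<^esub> y) = T x \<ominus>\<^bsub>K\<^esub> T y"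
proof -
  interpret H: complex_hilbert H by fact
  interpret K: complex_hilbert K by fact
  have "T x \<in> carrier K" "T y \<in> carrier K" using assms(3-5) by (auto simp: linear_operator_def)
  then show ?thesis using assms(3-5) by (simp add: linear_operator_def H.diff_eq K.diff_eq)
qed

lemma unitary_bounded: "unitary_operator H H U \<Longrightarrow> U \<in> bounded_operators H"
  unfolding bounded_operators_def using unitaryD(6)[of H H U]
  by (auto simp: unitary_operator_def intro!: exI[of _ 1])

lemma commutantD:
  assumes "T \<in> commutant H S"
  shows "T \<in> bounded_operators H" "\<lbrakk>A \<in> S; x \<in> carrier H\<rbrakk> \<Longrightarrow> T (A x) = A (T x)"
  using assms by (auto simp: commutant_def)

lemma commutantI:
  assumes "T \<in> bounded_operators H" "\<And>A x. \<lbrakk>A \<in> S; x \<in> carrier H\<rbrakk> \<Longrightarrow> T (A x) = A (T x)"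
  shows "T \<in> commutant H S"
  using assms by (simp add: commutant_def)

lemma abelian_inD:
  "\<lbrakk>abelian_in H M E; A \<in> M; B \<in> M; x \<in> carrier H\<rbrakk>
    \<Longrightarrow> E (A (E (B (E x)))) = E (B (E (A (E x))))"
  by (simp add: abelian_in_def)

text \<open>The elements \<open>a\<close> and \<open>b\<close> centralize a finite set
  \<open>F\<close> on which the nonzero vector \<open>f = E (dirac \<one>)\<close> nearly lives, so
  \<open>L g f\<close> and \<open>R (inv g) f\<close> nearly agree for \<open>g = a, b\<close>. As
  \<open>E\<close> commutes with right translations and fixes \<open>f\<close>, it can almost be
  dropped from \<open>E (L a (E (L b f)))\<close>.\<close>

theorem regular_rep_not_type_I:
  fixes G :: "'g monoid"
  assumes G: "group G" and UNIV: "carrier G = UNIV"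
    and noncommuting: "\<And>F. finite F \<Longrightarrow> \<exists>a b. (\<forall>x\<in>F. a \<otimes>\<^bsub>G\<^esub> x = x \<otimes>\<^bsub>G\<^esub> a \<and> b \<otimes>\<^bsub>G\<^esub> x = x \<otimes>\<^bsub>G\<^esub> b)
      \<and> b \<otimes>\<^bsub>G\<^esub> a \<otimes>\<^bsub>G\<^esub> inv\<^bsub>G\<^esub> (a \<otimes>\<^bsub>G\<^esub> b) \<notin> F"
  shows "\<not> type_I_group G"
proof
  assume I: "type_I_group G"
  interpret group G by fact
  have car [simp]: "g \<in> carrier G" for g by (simp add: UNIV)
  define L where "L = perm_rep G (\<lambda>g x. g \<otimes>\<^bsub>G\<^esub> x)"
  define R where "R = perm_rep G (\<lambda>g x. x \<otimes>\<^bsub>G\<^esub> inv\<^bsub>G\<^esub> g)"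
  interpret L: permutation_action G "\<lambda>g x. g \<otimes>\<^bsub>G\<^esub> x"
    by unfold_locales (simp_all add: m_assoc)
  interpret R: permutation_action G "\<lambda>g x. x \<otimes>\<^bsub>G\<^esub> inv\<^bsub>G\<^esub> g"
    by unfold_locales (simp_all add: m_assoc inv_mult_group)
  have LU: "unitary_operator l2 l2 (L g)" and RU: "unitary_operator l2 l2 (R g)" for g
    unfolding L_def R_def by (simp_all add: L.unitary_perm_rep R.unitary_perm_rep)
  note Lu = unitaryD[OF LU] and Ru = unitaryD[OF RU]
  have R_apply: "R g f x = f (x \<otimes>\<^bsub>G\<^esub> g)" and L_apply: "L g f x = f (inv\<^bsub>G\<^esub> g \<otimes>\<^bsub>G\<^esub> x)" for g f x
    by (simp_all add: R_def L_def perm_rep_def)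
  have LR: "L g (R h f) = R h (L g f)" for g h f
    by (rule ext) (simp add: R_apply L_apply m_assoc)
  have RR: "R g (R h f) = R (g \<otimes>\<^bsub>G\<^esub> h) f" for g h f
    by (rule ext) (simp add: R_apply m_assoc)
  define M where "M = generated_vN l2 (L ` carrier G)"
  \<comment> \<open>Everything in the double commutant \<open>M\<close>, in particular the
    projection \<open>E\<close> below, therefore commutes with right translations.\<close>
  have com: "R g \<in> commutant l2 (L ` carrier G)" for g
    by (rule commutantI[OF unitary_bounded[OF RU]]) (auto simp: LR)
  have LM: "L g \<in> M" for g
    unfolding M_def generated_vN_def
    by (rule commutantI[OF unitary_bounded[OF LU]]) (metis commutantD(2) car imageI)
  have id_bounded: "(\<lambda>x. x) \<in> bounded_operators l2" by (rule unitary_bounded[OF unitary_id])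
  have idM: "(\<lambda>x. x) \<in> M"
    unfolding M_def generated_vN_def by (rule commutantI[OF id_bounded]) simp
  \<comment> \<open>Type I is tested on the largest central projection, the identity. A basis vector
    shows that it is nonzero; \<open>undefined\<close> is merely some group element.\<close>
  have "vN_type_I l2 M"
    using I L.unitary_rep_perm_rep unfolding type_I_group_def M_def L_def by blast
  moreover have "dirac undefined \<noteq> (\<lambda>x. 0 :: complex)" by (auto simp: dirac_def fun_eq_iff)
  then have "nonzero_projection l2 M (\<lambda>x. x)"
    using idM by (auto simp: nonzero_projection_def simp del: l2_simps(4) intro!: bexI[OF _ dirac_mem])
  moreover have "central_in l2 M (\<lambda>x. x)" using idM by (simp add: central_in_def)
  ultimately obtain E where E: "nonzero_projection l2 M E" "abelian_in l2 M E"
    unfolding vN_type_I_def by blast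
  have EM: "E \<in> commutant l2 (commutant l2 (L ` carrier G))"
    using E(1) unfolding nonzero_projection_def M_def generated_vN_def by blast
  note Eb = commutantD(1)[OF EM] and ER = commutantD(2)[OF EM com]
  have Elin: "linear_operator l2 l2 E" using Eb by (simp add: bounded_operators_def)
  have Ec: "E f \<in> carrier l2" if "f \<in> carrier l2" for f
    using Elin that by (auto simp: linear_operator_def)
  have EE: "E (E f) = E f" if "f \<in> carrier l2" for f
    using E(1) that by (simp add: nonzero_projection_def)
  have Ed: "hnorm l2 (E f \<ominus>\<^bsub>l2\<^esub> E g) \<le> hnorm l2 (f \<ominus>\<^bsub>l2\<^esub> g)" if "f \<in> carrier l2" "g \<in> carrier l2" for f g
    using projection_contractive[OF hilbert_l2 Eb E(1), of "f \<ominus>\<^bsub>l2\<^esub> g"]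
      linear_operator_diff[OF hilbert_l2 hilbert_l2 Elin that] that by simp
  have Ld: "hnorm l2 (L k f \<ominus>\<^bsub>l2\<^esub> L k g) = hnorm l2 (f \<ominus>\<^bsub>l2\<^esub> g)"
    and Rd: "hnorm l2 (R k f \<ominus>\<^bsub>l2\<^esub> R k g) = hnorm l2 (f \<ominus>\<^bsub>l2\<^esub> g)"
    if "f \<in> carrier l2" "g \<in> carrier l2" for f g k
    using Lu(6)[of "f \<ominus>\<^bsub>l2\<^esub> g" k] Ru(6)[of "f \<ominus>\<^bsub>l2\<^esub> g" k] that
      unitary_diff[OF hilbert_l2 hilbert_l2 LU that] unitary_diff[OF hilbert_l2 hilbert_l2 RU that]
    by simp_all
  define f where "f = E (dirac \<one>\<^bsub>G\<^esub>)"
  have f: "f \<in> carrier l2" by (simp add: f_def Ec)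
  have Ef: "E f = f" by (simp add: f_def EE)
  \<comment> \<open>The right translates of \<open>dirac \<one>\<close> are all the basis vectors,
    so \<open>f = 0\<close> would make \<open>E\<close> kill each of them; self-adjointness then
    annihilates every coordinate of every \<open>E k\<close>.\<close>
  have fnz: "hnorm l2 f > 0"
  proof (rule ccontr)
    assume "\<not> hnorm l2 f > 0"
    then have "hnorm l2 f = 0" using l2.hnorm_nonneg[OF f] by linarith
    then have "cinner l2 f f = 0" using l2.cinner_self[OF f] by simp
    then have f0: "f = (\<lambda>x. 0)" using l2.cinner_eq_zero[OF f] by simp
    have "E (dirac g) = (\<lambda>x. 0)" for g
    proof -
      have "R (inv\<^bsub>G\<^esub> g) (dirac \<one>\<^bsub>G\<^esub>) = dirac g"
        unfolding R_def by (simp add: R.perm_rep_dirac)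
      then have "E (dirac g) = R (inv\<^bsub>G\<^esub> g) f" using ER[OF dirac_mem] by (metis f_def)
      then show ?thesis by (simp add: f0 R_apply fun_eq_iff)
    qed
    then have "E k x = 0" if "k \<in> carrier l2" for k x
      using E(1) that dirac_mem[of x] cinner_dirac[of "E k" x] unfolding nonzero_projection_def by auto
    then show False using E(1) by (auto simp: nonzero_projection_def fun_eq_iff)
  qed
  \<comment> \<open>Error budget in units of \<open>e\<close>: 8 for the two products, 2 for
    replacing \<open>f\<close> by \<open>s\<close> in the displacement under \<open>R c\<close>, 1
    for comparing the norms of \<open>f\<close> and \<open>s\<close>. This makes 11, against 12 for
    the norm of \<open>f\<close>.\<close>
  define e where "e = hnorm l2 f / 12"
  have e: "e > 0" using fnz by (simp add: e_def)
  obtain F where F: "finite F" "hnorm l2 (\<lambda>x. f x - cutoff F f x) < e"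
    using cutoff_approx[OF f e] by blast
  define s where "s = cutoff F f"
  have s: "s \<in> carrier l2" by (simp add: s_def F cutoff_mem)
  have fs: "hnorm l2 (f \<ominus>\<^bsub>l2\<^esub> s) \<le> e" using F(2) by (simp add: l2_diff[OF f s]) (simp add: s_def)
  \<comment> \<open>The quotients are included so that right translation by an element outside
    \<open>?F\<close> carries \<open>F\<close> off itself.\<close>
  let ?F = "F \<union> (\<lambda>(x, y). inv\<^bsub>G\<^esub> x \<otimes>\<^bsub>G\<^esub> y) ` (F \<times> F)"
  have "finite ?F" using F(1) by simp
  from noncommuting[OF this] obtain a b
    where ab0: "\<forall>x\<in>?F. a \<otimes>\<^bsub>G\<^esub> x = x \<otimes>\<^bsub>G\<^esub> a \<and> b \<otimes>\<^bsub>G\<^esub> x = x \<otimes>\<^bsub>G\<^esub> b"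
      and ab: "b \<otimes>\<^bsub>G\<^esub> a \<otimes>\<^bsub>G\<^esub> inv\<^bsub>G\<^esub> (a \<otimes>\<^bsub>G\<^esub> b) \<notin> ?F"
    by (elim exE conjE)
  have aF: "a \<otimes>\<^bsub>G\<^esub> x = x \<otimes>\<^bsub>G\<^esub> a" and bF: "b \<otimes>\<^bsub>G\<^esub> x = x \<otimes>\<^bsub>G\<^esub> b" if "x \<in> F" for x
    using bspec[OF ab0 UnI1[OF that]] by simp_all
  define c where "c = b \<otimes>\<^bsub>G\<^esub> a \<otimes>\<^bsub>G\<^esub> inv\<^bsub>G\<^esub> (a \<otimes>\<^bsub>G\<^esub> b)"
  \<comment> \<open>On \<open>s\<close> left translation by \<open>g\<close> is exactly right
    translation by \<open>inv g\<close>, because \<open>g\<close> centralizes \<open>F\<close>;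
    passing from \<open>f\<close> to \<open>s\<close> and back costs \<open>e\<close> each time.
    \<open>E\<close> does not increase distances and fixes the right translate of
    \<open>f\<close>.\<close>
  have near: "hnorm l2 (E (L g f) \<ominus>\<^bsub>l2\<^esub> R (inv\<^bsub>G\<^esub> g) f) \<le> 2 * e"
    if g: "\<And>x. x \<in> F \<Longrightarrow> g \<otimes>\<^bsub>G\<^esub> x = x \<otimes>\<^bsub>G\<^esub> g" for g
  proof -
    have "L g s = R (inv\<^bsub>G\<^esub> g) s"
    proof (rule ext)
      fix x
      have "inv\<^bsub>G\<^esub> g \<otimes>\<^bsub>G\<^esub> x = x \<otimes>\<^bsub>G\<^esub> inv\<^bsub>G\<^esub> g" if "inv\<^bsub>G\<^esub> g \<otimes>\<^bsub>G\<^esub> x \<in> F \<or> x \<otimes>\<^bsub>G\<^esub> inv\<^bsub>G\<^esub> g \<in> F"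
        using that
      proof
        assume "inv\<^bsub>G\<^esub> g \<otimes>\<^bsub>G\<^esub> x \<in> F"
        from g[OF this] have "inv\<^bsub>G\<^esub> g \<otimes>\<^bsub>G\<^esub> x \<otimes>\<^bsub>G\<^esub> g = g \<otimes>\<^bsub>G\<^esub> (inv\<^bsub>G\<^esub> g \<otimes>\<^bsub>G\<^esub> x)" ..
        also have "\<dots> = x" by (simp flip: m_assoc)
        finally show ?thesis using inv_solve_right[of "inv\<^bsub>G\<^esub> g \<otimes>\<^bsub>G\<^esub> x" x g] by simp
      next
        assume "x \<otimes>\<^bsub>G\<^esub> inv\<^bsub>G\<^esub> g \<in> F"
        from g[OF this] have "g \<otimes>\<^bsub>G\<^esub> (x \<otimes>\<^bsub>G\<^esub> inv\<^bsub>G\<^esub> g) = x" by (simp add: m_assoc)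
        then show ?thesis using inv_solve_left[of "x \<otimes>\<^bsub>G\<^esub> inv\<^bsub>G\<^esub> g" g x] by simp
      qed
      then show "L g s x = R (inv\<^bsub>G\<^esub> g) s x"
        by (auto simp: L_apply R_apply s_def cutoff_def)
    qed
    then have "hnorm l2 (L g f \<ominus>\<^bsub>l2\<^esub> R (inv\<^bsub>G\<^esub> g) f)
        \<le> hnorm l2 (L g f \<ominus>\<^bsub>l2\<^esub> L g s) + hnorm l2 (R (inv\<^bsub>G\<^esub> g) s \<ominus>\<^bsub>l2\<^esub> R (inv\<^bsub>G\<^esub> g) f)"
      using l2.hnorm_diff_triangle[of "L g f" "L g s" "R (inv\<^bsub>G\<^esub> g) f"] f s Lu(1) Ru(1) by simp
    also have "\<dots> \<le> 2 * e"
      using fs l2.hnorm_diff_commute[OF f s] by (simp add: Ld Rd f s)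
    finally have "hnorm l2 (L g f \<ominus>\<^bsub>l2\<^esub> R (inv\<^bsub>G\<^esub> g) f) \<le> 2 * e" .
    moreover have "E (R (inv\<^bsub>G\<^esub> g) f) = R (inv\<^bsub>G\<^esub> g) f" using ER[OF f] Ef by simp
    ultimately show ?thesis using Ed[OF Lu(1)[OF f, of g] Ru(1)[OF f, of "inv\<^bsub>G\<^esub> g"]] by simp
  qed
  have near2: "hnorm l2 (E (L g (E (L h f))) \<ominus>\<^bsub>l2\<^esub> R (inv\<^bsub>G\<^esub> (g \<otimes>\<^bsub>G\<^esub> h)) f) \<le> 4 * e"
    if g: "\<And>x. x \<in> F \<Longrightarrow> g \<otimes>\<^bsub>G\<^esub> x = x \<otimes>\<^bsub>G\<^esub> g" and h: "\<And>x. x \<in> F \<Longrightarrow> h \<otimes>\<^bsub>G\<^esub> x = x \<otimes>\<^bsub>G\<^esub> h" for g h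
  proof -
    let ?u = "E (L h f)" and ?v = "R (inv\<^bsub>G\<^esub> h) f"
    have uv: "?u \<in> carrier l2" "?v \<in> carrier l2" using f Ec Lu(1) Ru(1) by auto
    \<comment> \<open>Pulling the right translation out of \<open>E\<close> and \<open>L g\<close>
      reduces the outer factor to \<open>near\<close> for \<open>g\<close>.\<close>
    have "E (L g ?v) = R (inv\<^bsub>G\<^esub> h) (E (L g f))" using f Lu(1) by (simp add: LR ER)
    moreover have "R (inv\<^bsub>G\<^esub> (g \<otimes>\<^bsub>G\<^esub> h)) f = R (inv\<^bsub>G\<^esub> h) (R (inv\<^bsub>G\<^esub> g) f)"
      by (simp add: RR inv_mult_group)
    ultimately have "hnorm l2 (E (L g ?v) \<ominus>\<^bsub>l2\<^esub> R (inv\<^bsub>G\<^esub> (g \<otimes>\<^bsub>G\<^esub> h)) f) \<le> 2 * e"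
      using near[OF g] f Lu(1) Ru(1) Ec by (simp add: Rd)
    moreover have "hnorm l2 (E (L g ?u) \<ominus>\<^bsub>l2\<^esub> E (L g ?v)) \<le> 2 * e"
      using Ed[OF Lu(1)[OF uv(1), of g] Lu(1)[OF uv(2), of g]] near[OF h] by (simp add: Ld uv)
    ultimately show ?thesis
      using l2.hnorm_diff_triangle[of "E (L g ?u)" "E (L g ?v)" "R (inv\<^bsub>G\<^esub> (g \<otimes>\<^bsub>G\<^esub> h)) f"]
        uv f Lu(1) Ru(1) Ec by simp
  qed
  let ?p = "R (inv\<^bsub>G\<^esub> (a \<otimes>\<^bsub>G\<^esub> b)) f" and ?q = "R (inv\<^bsub>G\<^esub> (b \<otimes>\<^bsub>G\<^esub> a)) f" and ?m = "E (L a (E (L b f)))"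
  have pq: "?p \<in> carrier l2" "?q \<in> carrier l2" "?m \<in> carrier l2" using f Ec Lu(1) Ru(1) by auto
  \<comment> \<open>This is where \<open>E\<close> being abelian enters;
    \<open>f = E (dirac \<one>)\<close> supplies the innermost \<open>E\<close>. Hence
    \<open>?m\<close> is close to both \<open>?p\<close> and \<open>?q\<close>.\<close>
  have "?m = E (L b (E (L a f)))"
    unfolding f_def by (rule abelian_inD[OF E(2) LM LM dirac_mem])
  then have "hnorm l2 (?m \<ominus>\<^bsub>l2\<^esub> ?q) \<le> 4 * e" using near2[OF bF aF] by simp
  moreover have "hnorm l2 (?p \<ominus>\<^bsub>l2\<^esub> ?m) \<le> 4 * e"
    using near2[OF aF bF] l2.hnorm_diff_commute[OF pq(1,3)] by simp
  ultimately have "hnorm l2 (?p \<ominus>\<^bsub>l2\<^esub> ?q) \<le> 8 * e"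
    using l2.hnorm_diff_triangle[OF pq(1,3,2)] by linarith
  \<comment> \<open>A common right translation turns the pair \<open>?p\<close>, \<open>?q\<close>
    into \<open>R c f\<close> and \<open>f\<close>, with \<open>c\<close> the commutator.\<close>
  moreover have "R (b \<otimes>\<^bsub>G\<^esub> a) ?p = R c f" "R (b \<otimes>\<^bsub>G\<^esub> a) ?q = f"
    by (simp_all only: RR c_def) (simp add: R_apply fun_eq_iff)
  then have "hnorm l2 (R c f \<ominus>\<^bsub>l2\<^esub> f) = hnorm l2 (?p \<ominus>\<^bsub>l2\<^esub> ?q)"
    using Rd[OF pq(1,2), of "b \<otimes>\<^bsub>G\<^esub> a"] by simp
  ultimately have "hnorm l2 (R c f \<ominus>\<^bsub>l2\<^esub> f) \<le> 8 * e" by simp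
  moreover have "hnorm l2 (R c s \<ominus>\<^bsub>l2\<^esub> R c f) \<le> e"
    using fs l2.hnorm_diff_commute[OF f s] by (simp add: Rd f s)
  moreover have "hnorm l2 (R c s \<ominus>\<^bsub>l2\<^esub> s)
      \<le> hnorm l2 (R c s \<ominus>\<^bsub>l2\<^esub> R c f) + (hnorm l2 (R c f \<ominus>\<^bsub>l2\<^esub> f) + hnorm l2 (f \<ominus>\<^bsub>l2\<^esub> s))"
    using l2.hnorm_diff_triangle[OF Ru(1)[OF s, of c] Ru(1)[OF f, of c] s]
      l2.hnorm_diff_triangle[OF Ru(1)[OF f, of c] f s] by linarith
  ultimately have small: "hnorm l2 (R c s \<ominus>\<^bsub>l2\<^esub> s) \<le> 10 * e" using fs by linarith
  have "cinner l2 (R c s) s = 0"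
  proof (rule cinner_l2_disjoint)
    fix x show "R c s x = 0 \<or> s x = 0"
    proof (rule ccontr)
      assume "\<not> ?thesis"
      then have "x \<in> F" "x \<otimes>\<^bsub>G\<^esub> c \<in> F" by (auto simp: R_apply s_def cutoff_def split: if_splits)
      moreover have "c = inv\<^bsub>G\<^esub> x \<otimes>\<^bsub>G\<^esub> (x \<otimes>\<^bsub>G\<^esub> c)" by (simp flip: m_assoc)
      ultimately have "c \<in> (\<lambda>(x, y). inv\<^bsub>G\<^esub> x \<otimes>\<^bsub>G\<^esub> y) ` (F \<times> F)"
        by (intro image_eqI[of _ _ "(x, x \<otimes>\<^bsub>G\<^esub> c)"]) auto
      then show False using ab unfolding c_def[symmetric] by blast
    qed
  qed
  \<comment> \<open>\<open>R c s\<close> is orthogonal to \<open>s\<close> and has the same norm, so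
    their distance cannot fall below that norm.\<close>
  then have "(hnorm l2 (R c s \<ominus>\<^bsub>l2\<^esub> s))\<^sup>2 = (hnorm l2 s)\<^sup>2 + (hnorm l2 s)\<^sup>2"
    using s Ru(1)[OF s, of c] Ru(6)[OF s, of c]
    by (simp add: l2.diff_eq l2.hnorm_add_square l2.hnorm_smult l2.cinner_smult_right del: l2_simps)
  then have "(hnorm l2 s)\<^sup>2 \<le> (hnorm l2 (R c s \<ominus>\<^bsub>l2\<^esub> s))\<^sup>2" by simp
  then have "hnorm l2 s \<le> hnorm l2 (R c s \<ominus>\<^bsub>l2\<^esub> s)"
    by (rule power2_le_imp_le) (simp add: s Ru(1))
  moreover have "hnorm l2 f \<le> hnorm l2 (f \<ominus>\<^bsub>l2\<^esub> s) + hnorm l2 s"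
  proof -
    have "f = (f \<ominus>\<^bsub>l2\<^esub> s) \<oplus>\<^bsub>l2\<^esub> s" by (simp add: l2_diff[OF f s])
    then show ?thesis using l2.hnorm_triangle[of "f \<ominus>\<^bsub>l2\<^esub> s" s] f s by (metis l2.M.minus_closed)
  qed
  ultimately have "12 * e \<le> 11 * e" using small fs by (simp add: e_def)
  then show False using e by simp
qed

section \<open>Amenability of locally finite groups\<close>

text \<open>Left translation by an element of \<open>K\<close> permutes \<open>K\<close>; this makes
  the uniform measure on a finite subgroup invariant under that subgroup.\<close>

lemma card_l_coset_Int:
  assumes "subgroup K G" "group G" "g \<in> K" "A \<subseteq> carrier G"
  shows "card ((g <#\<^bsub>G\<^esub> A) \<inter> K) = card (A \<inter> K)"
proof -
  interpret group G by fact
  have K: "K \<subseteq> carrier G" using assms(1) by (rule subgroup.subset)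
  have g: "g \<in> carrier G" using K assms(3) by blast
  have "(g <#\<^bsub>G\<^esub> A) \<inter> K = (\<lambda>x. g \<otimes>\<^bsub>G\<^esub> x) ` (A \<inter> K)"
  proof (intro equalityI subsetI)
    fix y assume "y \<in> (g <#\<^bsub>G\<^esub> A) \<inter> K"
    then obtain x where x: "x \<in> A" "y = g \<otimes>\<^bsub>G\<^esub> x" "g \<otimes>\<^bsub>G\<^esub> x \<in> K"
      by (auto simp: l_coset_def)
    have "inv\<^bsub>G\<^esub> g \<otimes>\<^bsub>G\<^esub> (g \<otimes>\<^bsub>G\<^esub> x) \<in> K"
      by (rule subgroup.m_closed[OF assms(1) subgroup.m_inv_closed[OF assms(1,3)] x(3)])
    moreover have "x \<in> carrier G" using x(1) assms(4) by blast
    moreover have "inv\<^bsub>G\<^esub> g \<otimes>\<^bsub>G\<^esub> (g \<otimes>\<^bsub>G\<^esub> x) = x" if "x \<in> carrier G"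
      using g that by (simp flip: m_assoc)
    ultimately have "x \<in> K" by simp
    then show "y \<in> (\<lambda>x. g \<otimes>\<^bsub>G\<^esub> x) ` (A \<inter> K)" using x by blast
  next
    fix y assume "y \<in> (\<lambda>x. g \<otimes>\<^bsub>G\<^esub> x) ` (A \<inter> K)"
    then show "y \<in> (g <#\<^bsub>G\<^esub> A) \<inter> K"
      using subgroup.m_closed[OF assms(1,3)] by (auto simp: l_coset_def)
  qed
  moreover have "inj_on (\<lambda>x. g \<otimes>\<^bsub>G\<^esub> x) (A \<inter> K)"
    using g K by (intro inj_onI) (auto dest!: l_cancel)
  ultimately show ?thesis by (simp add: card_image)
qed

text \<open>Uniform measures on finite subgroups are invariant under finitely many prescribed
  elements at a time; compactness merges them into one measure invariant under the whole
  group.\<close>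

lemma amenable_locally_finite:
  fixes G :: "'a monoid"
  assumes G: "group G"
    and fin: "\<And>F. \<lbrakk>finite F; F \<subseteq> carrier G\<rbrakk> \<Longrightarrow> \<exists>K. finite K \<and> subgroup K G \<and> F \<subseteq> K"
  shows "amenable G"
proof -
  interpret group G by fact
  \<comment> \<open>The Tychonoff cube of all set functions with values in [0, 1], not yet required
    to be additive.\<close>
  define P :: "('a set \<Rightarrow> real) set" where "P = PiE UNIV (\<lambda>_. {0..1})"
  \<comment> \<open>Each condition equates expressions in finitely many coordinates, so
    \<open>C g\<close> is closed in the product topology.\<close>
  define C where "C g = {\<mu> :: 'a set \<Rightarrow> real. \<mu> (carrier G) = 1
      \<and> (\<forall>A B. A \<subseteq> carrier G \<and> B \<subseteq> carrier G \<and> A \<inter> B = {} \<longrightarrow> \<mu> (A \<union> B) = \<mu> A + \<mu> B)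
      \<and> (\<forall>A. A \<subseteq> carrier G \<longrightarrow> \<mu> (g <#\<^bsub>G\<^esub> A) = \<mu> A)}" for g
  have coord: "continuous_on UNIV (\<lambda>\<mu> :: 'a set \<Rightarrow> real. \<mu> A)" for A
    by (rule continuous_on_product_coordinates)
  have "compactin (product_topology (\<lambda>_. euclidean) UNIV) P"
    unfolding P_def by (subst compactin_PiE) simp
  then have "compact P" by (simp add: euclidean_product_topology)
  moreover have "closed (C g)" for g
    unfolding C_def
    by (intro closed_Collect_conj closed_Collect_all closed_Collect_imp open_Collect_const
        closed_Collect_eq continuous_on_add continuous_on_const coord)
  moreover have "P \<inter> (\<Inter>g\<in>F. C g) \<noteq> {}" if F: "finite F" "F \<subseteq> carrier G" for F
  proof -
    obtain K where K: "finite K" "subgroup K G" "F \<subseteq> K" using fin[OF F] by blast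
    have sub: "K \<subseteq> carrier G" using K(2) by (rule subgroup.subset)
    have pos: "card K > 0"
      using K(1) subgroup.one_closed[OF K(2)] by (auto simp: card_gt_0_iff)
    define \<mu> where "\<mu> A = real (card (A \<inter> K)) / real (card K)" for A
    have "\<mu> A \<le> 1" for A
      using card_mono[OF K(1), of "A \<inter> K"] pos by (simp add: \<mu>_def)
    then have "\<mu> \<in> P" by (auto simp: P_def \<mu>_def)
    moreover have "\<mu> (carrier G) = 1"
      using sub pos by (simp add: \<mu>_def Int_absorb1)
    moreover have "\<mu> (A \<union> B) = \<mu> A + \<mu> B" if "A \<inter> B = {}" for A B
    proof -
      have "card ((A \<inter> K) \<union> (B \<inter> K)) = card (A \<inter> K) + card (B \<inter> K)"
        using K(1) that by (intro card_Un_disjoint) auto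
      then show ?thesis by (simp add: \<mu>_def Int_Un_distrib2 add_divide_distrib)
    qed
    moreover have "\<mu> (g <#\<^bsub>G\<^esub> A) = \<mu> A" if "g \<in> F" "A \<subseteq> carrier G" for g A
    proof -
      have "g \<in> K" using K(3) that(1) by blast
      then show ?thesis using card_l_coset_Int[OF K(2) G _ that(2)] by (simp add: \<mu>_def)
    qed
    ultimately have "\<mu> \<in> P \<inter> (\<Inter>g\<in>F. C g)" by (simp add: C_def)
    then show ?thesis by blast
  qed
  ultimately have "P \<inter> (\<Inter>g\<in>carrier G. C g) \<noteq> {}"
    by (rule compact_imp_fip_image)
  then obtain \<mu> where \<mu>: "\<mu> \<in> P" "\<And>g. g \<in> carrier G \<Longrightarrow> \<mu> \<in> C g" by blast
  have "0 \<le> \<mu> A" for A using \<mu>(1) PiE_mem[of \<mu> UNIV "\<lambda>_. {0..1}" A] by (simp add: P_def)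
  then show ?thesis
    unfolding amenable_def using \<mu>(2)[OF one_closed] \<mu>(2) by (intro exI[of _ \<mu>]) (simp add: C_def)
qed

section \<open>Twisted conjugacy and fixed points of the dual\<close>

text \<open>\<open>lang\<close> expresses x = g \<phi>(g)^-1 without inverses, that is, surjectivity
  of the Lang map; every element is then twisted conjugate to the identity.\<close>

lemma reidemeister_number_eq_1:
  assumes G: "group G" and \<phi>: "\<phi> \<in> iso G G"
    and lang: "\<And>x. x \<in> carrier G \<Longrightarrow> \<exists>g\<in>carrier G. g = x \<otimes>\<^bsub>G\<^esub> \<phi> g"
  shows "reidemeister_number G \<phi> = 1"
proof -
  interpret group G by fact
  interpret f: group_hom G G \<phi>
    using G \<phi> by (simp add: group_hom_def group_hom_axioms_def iso_def)
  note eq = equiv_twisted_conjugacy[OF G \<phi>]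
  have one: "(\<one>\<^bsub>G\<^esub>, x) \<in> twisted_conjugacy G \<phi>" if x: "x \<in> carrier G" for x
  proof -
    obtain g where g: "g \<in> carrier G" "g = x \<otimes>\<^bsub>G\<^esub> \<phi> g" using lang[OF x] by blast
    have "x = g \<otimes>\<^bsub>G\<^esub> inv\<^bsub>G\<^esub> \<phi> g"
      by (rule iffD2[OF inv_solve_right[OF x g(1) f.hom_closed[OF g(1)]] g(2)])
    then have "x = g \<otimes>\<^bsub>G\<^esub> \<one>\<^bsub>G\<^esub> \<otimes>\<^bsub>G\<^esub> \<phi> (inv\<^bsub>G\<^esub> g)"
      by (simp only: f.hom_inv[OF g(1)] r_one[OF g(1)])
    then show ?thesis unfolding twisted_conjugacy_def
      by (intro CollectI case_prodI conjI one_closed x bexI[OF _ g(1)])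
  qed
  have "C = twisted_conjugacy G \<phi> `` {\<one>\<^bsub>G\<^esub>}" if "C \<in> carrier G // twisted_conjugacy G \<phi>" for C
    using that
  proof (rule quotientE)
    fix x assume "x \<in> carrier G" "C = twisted_conjugacy G \<phi> `` {x}"
    then show ?thesis using equiv_class_eq[OF eq one] by simp
  qed
  moreover have "twisted_conjugacy G \<phi> `` {\<one>\<^bsub>G\<^esub>} \<in> carrier G // twisted_conjugacy G \<phi>"
    by (rule quotientI[OF one_closed])
  ultimately have "carrier G // twisted_conjugacy G \<phi> = {twisted_conjugacy G \<phi> `` {\<one>\<^bsub>G\<^esub>}}"
    by blast
  then show ?thesis by (simp add: reidemeister_number_def ecard_def one_enat_def)
qed

text \<open>\<rho> may live on any type, so an equivalent copy inside the universe of
  \<open>irreps\<close> is taken, and the equivalence of \<rho> \<circ> \<phi> with \<rho> is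
  carried over to it.\<close>

lemma fixed_class:
  fixes H :: "'h hilbert_space" and G :: "'g monoid"
  assumes G: "group G" and \<phi>: "\<phi> \<in> iso G G" and irr: "irreducible_rep G H \<rho>"
    and equiv: "unitarily_equivalent G H (\<rho> \<circ> \<phi>) H \<rho>"
  obtains K \<sigma> where "unitarily_equivalent G H \<rho> K \<sigma>" "(K, \<sigma>) \<in> irreps G"
    "rep_equiv G `` {(K, \<sigma>)} \<in> {C \<in> unitary_dual G. dual_map G \<phi> C = C}"
proof -
  obtain K \<sigma> where K: "(K, \<sigma>) \<in> irreps G" "unitarily_equivalent G H \<rho> K \<sigma>"
    using irreducible_rep_universe[OF G irr] by blast
  have rep: "unitary_rep G H \<rho>" "complex_hilbert H" and Kh: "complex_hilbert K"
    using irr K(1) by (auto simp: irreps_def irreducible_rep_def unitary_rep_def)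
  have \<phi>g: "\<phi> g \<in> carrier G" if "g \<in> carrier G" for g
    using \<phi> that by (auto simp: iso_def hom_def)
  have "unitarily_equivalent G K \<sigma> H \<rho>"
    by (rule unitarily_equivalent_sym[OF rep(1) Kh K(2)])
  then have "unitarily_equivalent G K (\<sigma> \<circ> \<phi>) H (\<rho> \<circ> \<phi>)"
    unfolding unitarily_equivalent_def using \<phi>g by auto
  then have "unitarily_equivalent G K (\<sigma> \<circ> \<phi>) K \<sigma>"
    by (rule unitarily_equivalent_trans[OF unitarily_equivalent_trans[OF _ equiv] K(2)])
  then have "((K, \<sigma> \<circ> \<phi>), (K, \<sigma>)) \<in> rep_equiv G"
    using irreps_comp[OF \<phi> K(1)] K(1) by (simp add: rep_equiv_def)
  then have "dual_map G \<phi> (rep_equiv G `` {(K, \<sigma>)}) = rep_equiv G `` {(K, \<sigma>)}"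
    using dual_map_class[OF \<phi> K(1)] equiv_class_eq[OF equiv_rep_equiv] by metis
  moreover have "rep_equiv G `` {(K, \<sigma>)} \<in> unitary_dual G"
    unfolding unitary_dual_def by (rule quotientI[OF K(1)])
  ultimately show ?thesis by (intro that[OF K(2,1)] CollectI conjI)
qed

lemma ecard_ne_1: "\<lbrakk>A \<in> S; B \<in> S; A \<noteq> B\<rbrakk> \<Longrightarrow> ecard S \<noteq> 1"
  by (auto simp: ecard_def one_enat_def card_1_singleton_iff)

context mixing_action
begin

text \<open>Precomposition with \<open>s\<close> is the intertwiner, since \<open>s\<close> carries
  the action of \<open>g\<close> to that of \<open>\<phi> g\<close>.\<close>

lemma perm_rep_twist_equivalent:
  assumes s: "bij s" "\<And>g x. g \<in> carrier G \<Longrightarrow> s (act g x) = act (\<phi> g) (s x)"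
    and \<phi>: "\<phi> \<in> iso G G"
  shows "unitarily_equivalent G l2 (perm_rep G act \<circ> \<phi>) l2 (perm_rep G act)"
  unfolding unitarily_equivalent_def
proof (intro exI conjI ballI)
  show "unitary_operator l2 l2 (\<lambda>f. f \<circ> s)" by (rule unitary_reindex[OF s(1)])
  interpret f: group_hom G G \<phi>
    using \<phi> by (simp add: group_hom_def group_hom_axioms_def iso_def is_group)
  fix g and f :: "'b \<Rightarrow> complex" assume g: "g \<in> carrier G"
  show "(perm_rep G act \<circ> \<phi>) g f \<circ> s = perm_rep G act g (f \<circ> s)"
    using g s(2)[OF inv_closed[OF g]] by (simp add: perm_rep_def fun_eq_iff f.hom_inv)
qed

text \<open>Two different classes are fixed, the trivial one and that of
  \<open>perm_rep G act\<close>. They differ because an intertwiner would make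
  \<open>dirac p\<close> invariant, whereas some \<open>g\<close> moves it to
  \<open>dirac x\<close>.\<close>

lemma dual_fixed_points_ne_1:
  assumes \<phi>: "\<phi> \<in> iso G G"
    and s: "bij s" "\<And>g x. g \<in> carrier G \<Longrightarrow> s (act g x) = act (\<phi> g) (s x)"
    and nontrivial: "x \<noteq> p"
  shows "dual_fixed_points G \<phi> \<noteq> 1"
proof -
  let ?S = "{C \<in> unitary_dual G. dual_map G \<phi> C = C}"
  \<comment> \<open>The trivial representation arises as the permutation representation on one
    point.\<close>
  interpret triv: mixing_action G "\<lambda>g x. x" "()"
    by unfold_locales auto
  let ?t = "perm_rep G (\<lambda>g x :: unit. x)" and ?r = "perm_rep G act"
  obtain K \<sigma> where K: "unitarily_equivalent G l2 ?r K \<sigma>" "(K, \<sigma>) \<in> irreps G" "rep_equiv G `` {(K, \<sigma>)} \<in> ?S"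
    by (rule fixed_class[OF is_group \<phi> irreducible_perm_rep perm_rep_twist_equivalent[OF s \<phi>]])
  have tt: "unitarily_equivalent G l2 (?t \<circ> \<phi>) l2 ?t"
    using triv.perm_rep_twist_equivalent[OF bij_id _ \<phi>] by simp
  obtain T \<tau> where T: "unitarily_equivalent G l2 ?t T \<tau>" "(T, \<tau>) \<in> irreps G" "rep_equiv G `` {(T, \<tau>)} \<in> ?S"
    by (rule fixed_class[OF is_group \<phi> triv.irreducible_perm_rep tt])
  have ne: "rep_equiv G `` {(K, \<sigma>)} \<noteq> rep_equiv G `` {(T, \<tau>)}"
  proof
    assume eq: "rep_equiv G `` {(K, \<sigma>)} = rep_equiv G `` {(T, \<tau>)}"
    have "((T, \<tau>), (K, \<sigma>)) \<in> rep_equiv G"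
      by (rule eq_equiv_class[OF eq[symmetric] equiv_rep_equiv K(2)])
    then have "unitarily_equivalent G T \<tau> K \<sigma>" by (simp add: rep_equiv_def)
    moreover have "unitarily_equivalent G K \<sigma> l2 ?r"
      using K by (intro unitarily_equivalent_sym[OF unitary_rep_perm_rep])
        (auto simp: irreps_def irreducible_rep_def unitary_rep_def)
    ultimately have "unitarily_equivalent G l2 ?t l2 ?r"
      by (rule unitarily_equivalent_trans[OF unitarily_equivalent_trans[OF T(1)]])
    then obtain U where U: "unitary_operator l2 l2 U"
        "\<And>g f. g \<in> carrier G \<Longrightarrow> f \<in> carrier l2 \<Longrightarrow> U (?t g f) = ?r g (U f)"
      unfolding unitarily_equivalent_def by blast
    obtain f where f: "f \<in> carrier l2" "U f = dirac p"
      using unitaryD(5)[OF U(1), symmetric] dirac_mem[of p] by auto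
    obtain g where g: "g \<in> carrier G" "act g p = x" using transitive by blast
    have "?t g f = f" by (simp add: perm_rep_def)
    then have "dirac p = ?r g (dirac p)" using U(2)[OF g(1) f(1)] f(2) by simp
    then have "dirac p p = dirac x p" using perm_rep_dirac[OF g(1)] g(2) by simp
    then show False using nontrivial by (simp add: dirac_def split: if_splits)
  qed
  from ecard_ne_1[OF K(3) T(3) ne] show ?thesis unfolding dual_fixed_points_def .
qed

end

section \<open>Restricted wreath products\<close>

abbreviation lookup where "lookup \<equiv> Poly_Mapping.lookup"
abbreviation keys where "keys \<equiv> Poly_Mapping.keys"

definition shift :: "'h \<Rightarrow> ('h::ab_group_add \<Rightarrow>\<^sub>0 'l::zero) \<Rightarrow> ('h \<Rightarrow>\<^sub>0 'l)"
  where "shift h = Poly_Mapping.map_key (\<lambda>x. x - h)"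

lemma lookup_shift [simp]: "lookup (shift h v) x = lookup v (x - h)"
  by (simp add: shift_def map_key.rep_eq inj_def)

lemma shift_add: "shift h (v + w) = shift h v + shift h w"
  by (rule poly_mapping_eqI) (simp add: lookup_add)

lemma shift_zero [simp]: "shift h 0 = 0" "shift 0 v = v"
  by (auto intro: poly_mapping_eqI)

lemma shift_shift [simp]: "shift h (shift k v) = shift (h + k) v"
  by (auto intro!: poly_mapping_eqI simp: algebra_simps)

text \<open>Finitely supported functions form the base group, hence the restricted wreath product.
  Addition in \<open>'l\<close> need not commute, so the order of summands matters.\<close>

definition wreath :: "(('h::ab_group_add \<Rightarrow>\<^sub>0 'l::group_add) \<times> 'h) monoid"
  where "wreath = \<lparr>carrier = UNIV, monoid.mult = (\<lambda>(v, h) (w, k). (v + shift h w, h + k)), one = (0, 0)\<rparr>"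

lemma wreath_simps [simp]:
  "carrier wreath = UNIV" "(v, h) \<otimes>\<^bsub>wreath\<^esub> (w, k) = (v + shift h w, h + k)" "\<one>\<^bsub>wreath\<^esub> = (0, 0)"
  by (simp_all add: wreath_def)

lemma left_neg: "\<exists>w. w + v = 0" for v :: "'h \<Rightarrow>\<^sub>0 'l::group_add"
proof
  show "Poly_Mapping.map uminus v + v = 0"
    by (rule poly_mapping_eqI) (simp add: lookup_add map.rep_eq when_def)
qed

lemma group_wreath: "group wreath"
proof (rule groupI)
  fix x :: "('h::ab_group_add \<Rightarrow>\<^sub>0 'l::group_add) \<times> 'h"
  obtain v h where x: "x = (v, h)" by (cases x)
  obtain w where "w + shift (-h) v = 0" using left_neg by blast
  then show "\<exists>y\<in>carrier wreath. y \<otimes>\<^bsub>wreath\<^esub> x = \<one>\<^bsub>wreath\<^esub>"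
    by (intro bexI[of _ "(w, -h)"]) (auto simp: x)
qed (auto simp: shift_add add.assoc)

lemma lookup_map_uminus [simp]:
  "lookup (Poly_Mapping.map uminus v) x = - lookup v x" for v :: "'h \<Rightarrow>\<^sub>0 'l::group_add"
  by (simp add: map.rep_eq when_def)

lemma inv_wreath [simp]:
  "inv\<^bsub>wreath\<^esub> (v, h) = (Poly_Mapping.map uminus (shift (- h) v), - h)"
  by (rule group.inv_equality[OF group_wreath])
    (auto intro!: poly_mapping_eqI simp: lookup_add)

text \<open>The action on the cosets of the top group, which the base group represents.\<close>

definition wreath_act :: "('h::ab_group_add \<Rightarrow>\<^sub>0 'l::group_add) \<times> 'h \<Rightarrow> ('h \<Rightarrow>\<^sub>0 'l) \<Rightarrow> ('h \<Rightarrow>\<^sub>0 'l)"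
  where "wreath_act g w = fst g + shift (snd g) w"

lemma wreath_act_mult: "wreath_act (g \<otimes>\<^bsub>wreath\<^esub> h) w = wreath_act g (wreath_act h w)"
  by (cases g; cases h) (simp add: wreath_act_def shift_add add.assoc)

section \<open>Supports, local finiteness and its consequences\<close>

lemma keys_shift: "keys (shift h v) = (\<lambda>x. x + h) ` keys v"
  by (auto simp: in_keys_iff intro!: image_eqI[of _ _ "_ - h"])

text \<open>Containing 0 and closed under differences means that \<open>K\<close> is a subgroup, so
  this is local finiteness in the usual sense for an abelian group.\<close>

definition locally_finite :: "'h::ab_group_add itself \<Rightarrow> bool"
  where "locally_finite _ \<longleftrightarrow> (\<forall>S :: 'h set. finite S \<longrightarrow>
    (\<exists>K. finite K \<and> S \<subseteq> K \<and> 0 \<in> K \<and> (\<forall>x\<in>K. \<forall>y\<in>K. x - y \<in> K)))"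

lemma locally_finiteE:
  assumes "locally_finite TYPE('h::ab_group_add)" "finite S"
  obtains K where "finite K" "S \<subseteq> K" "(0 :: 'h) \<in> K" "\<And>x y. x \<in> K \<Longrightarrow> y \<in> K \<Longrightarrow> x - y \<in> K"
    "\<And>x y. x \<in> K \<Longrightarrow> y \<in> K \<Longrightarrow> x + y \<in> K" "\<And>x. x \<in> K \<Longrightarrow> - x \<in> K"
proof -
  obtain K where K: "finite K" "S \<subseteq> K" "(0 :: 'h) \<in> K" "\<And>x y. x \<in> K \<Longrightarrow> y \<in> K \<Longrightarrow> x - y \<in> K"
    using assms unfolding locally_finite_def by meson
  have neg: "- x \<in> K" if "x \<in> K" for x using K(4)[OF K(3) that] by simp
  have "x + y \<in> K" if "x \<in> K" "y \<in> K" for x y using K(4)[OF that(1) neg[OF that(2)]] by simp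
  then show ?thesis using that[OF K] neg by blast
qed

text \<open>Collect all supports from \<open>S\<close> in a finite subgroup \<open>K\<close>. A
  shift by \<open>t\<close> outside \<open>K\<close> takes a support point out of \<open>K\<close>,
  and the top-group element \<open>(0, t)\<close> fixes the base point 0.\<close>

lemma wreath_mixing:
  fixes S :: "('h::ab_group_add \<Rightarrow>\<^sub>0 'l::group_add) set"
  assumes lf: "locally_finite TYPE('h)" and inf: "infinite (UNIV :: 'h set)"
    and S: "finite S" "0 \<notin> S"
  shows "\<exists>g. wreath_act g 0 = 0 \<and> wreath_act g ` S \<inter> S = {}"
proof -
  obtain K where K: "finite K" "(\<Union>v\<in>S. keys v) \<subseteq> K"
      "\<And>x y. x \<in> K \<Longrightarrow> y \<in> K \<Longrightarrow> x - y \<in> K"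
    by (rule locally_finiteE[OF lf, of "\<Union>v\<in>S. keys v"]) (use S(1) in auto)
  obtain t where t: "t \<notin> K" using ex_new_if_finite[OF inf K(1)] by blast
  have "shift t v \<notin> S" if v: "v \<in> S" for v
  proof
    assume vS: "shift t v \<in> S"
    obtain x where x: "x \<in> keys v" using v S(2) by (metis keys_eq_empty all_not_in_conv)
    then have "x + t \<in> keys (shift t v)" by (auto simp: keys_shift)
    then have "x + t \<in> K" "x \<in> K" using K(2) vS v x by auto
    then show False using K(3)[of "x + t" x] t by simp
  qed
  then show ?thesis by (intro exI[of _ "(0, t)"]) (auto simp: wreath_act_def)
qed

lemma finite_keys_subset:
  assumes "finite K"
  shows "finite {v :: 'h \<Rightarrow>\<^sub>0 'l::{finite, zero}. keys v \<subseteq> K}"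
proof (rule finite_imageD)
  have "lookup ` {v :: 'h \<Rightarrow>\<^sub>0 'l. keys v \<subseteq> K}
      \<subseteq> {f. \<forall>x. (x \<in> K \<longrightarrow> f x \<in> UNIV) \<and> (x \<notin> K \<longrightarrow> f x = 0)}"
    by (auto simp: in_keys_iff)
  then show "finite (lookup ` {v :: 'h \<Rightarrow>\<^sub>0 'l. keys v \<subseteq> K})"
    by (rule finite_subset) (intro finite_set_of_finite_funs assms finite)
qed (auto intro: inj_onI)

text \<open>Configurations supported on a finite subgroup \<open>K\<close>, together with
  \<open>K\<close> as top group, form a subgroup; it is finite because the lamp group is.\<close>

lemma wreath_locally_finite:
  fixes F :: "(('h::ab_group_add \<Rightarrow>\<^sub>0 'l::{group_add, finite}) \<times> 'h) set"
  assumes lf: "locally_finite TYPE('h)" and F: "finite F"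
  shows "\<exists>K. finite K \<and> subgroup K wreath \<and> F \<subseteq> K"
proof -
  obtain K where K: "finite K" "(\<Union>(v, h)\<in>F. insert h (keys v)) \<subseteq> K" "0 \<in> K"
      "\<And>x y. x \<in> K \<Longrightarrow> y \<in> K \<Longrightarrow> x - y \<in> K" "\<And>x y. x \<in> K \<Longrightarrow> y \<in> K \<Longrightarrow> x + y \<in> K"
      "\<And>x. x \<in> K \<Longrightarrow> - x \<in> K"
    by (rule locally_finiteE[OF lf, of "\<Union>(v, h)\<in>F. insert h (keys v)"]) (use F in auto)
  define K' where "K' = {v :: 'h \<Rightarrow>\<^sub>0 'l. keys v \<subseteq> K} \<times> K"
  interpret group "wreath :: (('h \<Rightarrow>\<^sub>0 'l) \<times> 'h) monoid" by (rule group_wreath)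
  have sh: "keys (shift h v) \<subseteq> K" if "h \<in> K" "keys v \<subseteq> K" for h and v :: "'h \<Rightarrow>\<^sub>0 'l"
    using that K(5) by (auto simp: keys_shift)
  have pl: "keys (v + w) \<subseteq> K" if "keys v \<subseteq> K" "keys w \<subseteq> K" for v w :: "'h \<Rightarrow>\<^sub>0 'l"
    using that keys_add[of v w] by blast
  have mi: "keys (Poly_Mapping.map uminus v) \<subseteq> K" if "keys v \<subseteq> K" for v :: "'h \<Rightarrow>\<^sub>0 'l"
    using that by (auto simp: in_keys_iff)
  have "subgroup K' wreath"
    by (rule subgroupI) (use K(3,5,6) in \<open>auto simp: K'_def sh pl mi intro!: exI[of _ 0] intro: sh pl mi del: subsetI\<close>)
  moreover have "finite K'" unfolding K'_def using finite_keys_subset[OF K(1)] K(1) by blast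
  moreover have "F \<subseteq> K'" using K(2) by (force simp: K'_def)
  ultimately show ?thesis by blast
qed

text \<open>For \<open>t\<close> outside a finite subgroup \<open>K\<close>, configurations constant
  on the coset \<open>K + t\<close> and zero elsewhere are invariant under shifts by
  \<open>K\<close> and have support disjoint from \<open>K\<close>. They commute with everything
  built from \<open>K\<close>, but two of them with values \<open>u\<close> and \<open>u'\<close> do
  not commute with each other.\<close>

lemma wreath_noncommuting:
  fixes F :: "(('h::ab_group_add \<Rightarrow>\<^sub>0 'l::group_add) \<times> 'h) set" and u u' :: 'l
  assumes lf: "locally_finite TYPE('h)" and inf: "infinite (UNIV :: 'h set)"
    and u: "u + u' \<noteq> u' + u" and F: "finite F"
  shows "\<exists>a b. (\<forall>x\<in>F. a \<otimes>\<^bsub>wreath\<^esub> x = x \<otimes>\<^bsub>wreath\<^esub> a \<and> b \<otimes>\<^bsub>wreath\<^esub> x = x \<otimes>\<^bsub>wreath\<^esub> b)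
    \<and> b \<otimes>\<^bsub>wreath\<^esub> a \<otimes>\<^bsub>wreath\<^esub> inv\<^bsub>wreath\<^esub> (a \<otimes>\<^bsub>wreath\<^esub> b) \<notin> F"
proof -
  obtain K where K: "finite K" "(\<Union>(v, h)\<in>F. insert h (keys v)) \<subseteq> K" "0 \<in> K"
      "\<And>x y. x \<in> K \<Longrightarrow> y \<in> K \<Longrightarrow> x - y \<in> K" "\<And>x y. x \<in> K \<Longrightarrow> y \<in> K \<Longrightarrow> x + y \<in> K"
    by (rule locally_finiteE[OF lf, of "\<Union>(v, h)\<in>F. insert h (keys v)"]) (use F in auto)
  obtain t where t: "t \<notin> K" using ex_new_if_finite[OF inf K(1)] by blast
  define c where "c z = Abs_poly_mapping (\<lambda>x. if x - t \<in> K then z else 0)" for z :: 'l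
  have "finite {x. (if x - t \<in> K then z else 0) \<noteq> 0}" for z :: 'l
  proof (rule finite_subset)
    show "{x. (if x - t \<in> K then z else 0) \<noteq> 0} \<subseteq> (\<lambda>x. x + t) ` K"
      by (auto split: if_splits intro!: image_eqI[of _ _ "_ - t"])
  qed (use K(1) in simp)
  then have c: "lookup (c z) x = (if x - t \<in> K then z else 0)" for z x
    by (simp add: c_def)
  have comm: "(c z, 0) \<otimes>\<^bsub>wreath\<^esub> x = x \<otimes>\<^bsub>wreath\<^esub> (c z, 0)" if "x \<in> F" for z x
  proof -
    obtain v h where x: "x = (v, h)" by (cases x)
    have h: "h \<in> K" and v: "keys v \<subseteq> K" using K(2) that x by auto
    have "x - h - t \<in> K \<longleftrightarrow> x - t \<in> K" for x
      using K(4)[OF _ h, of "x - t"] K(5)[OF _ h, of "x - h - t"] by (auto simp: algebra_simps)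
    then have "shift h (c z) = c z" by (intro poly_mapping_eqI) (simp add: c)
    \<comment> \<open>The coset \<open>K + t\<close> misses \<open>K\<close>, hence the support of
      \<open>v\<close>.\<close>
    moreover have "lookup v y = 0" if "y - t \<in> K" for y
      using K(4)[OF _ that, of y] t v by (force simp: in_keys_iff)
    then have "c z + v = v + c z" by (intro poly_mapping_eqI) (simp add: c lookup_add)
    ultimately show ?thesis by (simp add: x)
  qed
  \<comment> \<open>The base component of the commutator. It is nonzero at \<open>t\<close>, which
    lies outside every support occurring in \<open>F\<close>.\<close>
  let ?d = "c u' + c u + Poly_Mapping.map uminus (c u + c u')"
  have "lookup ?d t = u' + u - (u + u')" using K(3) by (simp add: lookup_add c)
  then have "t \<in> keys ?d" using u by (simp add: in_keys_iff)
  then have "(?d, 0) \<notin> F" using K(2) t by auto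
  then show ?thesis
    using comm by (intro exI[of _ "(c u, 0)"] exI[of _ "(c u', 0)"]) simp
qed

section \<open>Solvability of the wreath product\<close>

lemma (in group) derived_subset:
  assumes "subgroup K G" "\<And>x y. x \<in> H \<Longrightarrow> y \<in> H \<Longrightarrow> x \<otimes> y \<otimes> inv x \<otimes> inv y \<in> K"
  shows "derived G H \<subseteq> K"
  unfolding derived_def by (rule generate_subgroup_incl[OF _ assms(1)]) (use assms(2) in blast)

text \<open>\<open>central\<close> makes the lamp group nilpotent of class at most 2. The derived
  series descends into the base group \<open>A\<close>, then into the configurations
  \<open>B\<close> with central values, which commute with each other.\<close>

lemma solvable_wreath:
  assumes central: "\<And>a b c :: 'l::group_add. a + b - a - b + c = c + (a + b - a - b)"
  shows "solvable (wreath :: (('h::ab_group_add \<Rightarrow>\<^sub>0 'l) \<times> 'h) monoid)"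
proof -
  let ?W = "wreath :: (('h \<Rightarrow>\<^sub>0 'l) \<times> 'h) monoid"
  interpret group ?W by (rule group_wreath)
  define Z where "Z = {z :: 'l. \<forall>c. z + c = c + z}"
  define A where "A = {(v :: 'h \<Rightarrow>\<^sub>0 'l, h :: 'h). h = 0}"
  define B where "B = {(v :: 'h \<Rightarrow>\<^sub>0 'l, h :: 'h). h = 0 \<and> (\<forall>x. lookup v x \<in> Z)}"
  have Z0: "0 \<in> Z" by (simp add: Z_def)
  have Z_add: "x + y \<in> Z" if "x \<in> Z" "y \<in> Z" for x y
  proof -
    have "x + y + c = c + (x + y)" for c
    proof -
      have "x + y + c = x + c + y" using that(2) by (simp add: Z_def add.assoc)
      also have "\<dots> = c + (x + y)" using that(1) by (simp add: Z_def add.assoc)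
      finally show ?thesis .
    qed
    then show ?thesis by (simp add: Z_def)
  qed
  have Z_minus: "- x \<in> Z" if "x \<in> Z" for x
  proof -
    \<comment> \<open>Commuting \<open>x\<close> past this particular element and cancelling on both
      sides leaves \<open>c + - x = - x + c\<close>.\<close>
    have "x + (- x + c + - x) = (- x + c + - x) + x" for c using that by (simp add: Z_def)
    moreover have "x + (- x + c + - x) = c + - x" "(- x + c + - x) + x = - x + c" for c
      by (simp_all only: add.assoc left_minus add_0_right minus_add_cancel add_minus_cancel)
    ultimately have "- x + c = c + - x" for c by metis
    then show ?thesis by (simp add: Z_def)
  qed
  have sA: "subgroup A ?W" by (rule subgroupI) (auto simp: A_def)
  have sB: "subgroup B ?W" by (rule subgroupI) (auto simp: B_def lookup_add Z0 Z_add Z_minus intro!: exI[of _ 0])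
  have 1: "derived ?W UNIV \<subseteq> A"
    by (rule derived_subset[OF sA]) (auto simp: A_def)
  have "derived ?W A \<subseteq> B"
    by (rule derived_subset[OF sB]) (use central in \<open>auto simp: A_def B_def Z_def lookup_add\<close>)
  then have 2: "derived ?W (derived ?W UNIV) \<subseteq> B"
    using mono_derived[OF 1] by auto
  have "derived ?W B \<subseteq> {\<one>\<^bsub>?W\<^esub>}"
  proof (rule derived_subset[OF triv_subgroup])
    fix x y assume xy: "x \<in> B" "y \<in> B"
    then obtain v w where "x = (v, 0)" "y = (w, 0)"
      and v: "\<And>z c. lookup v z + c = c + lookup v z"
      by (auto simp: B_def Z_def)
    moreover have "lookup v z + lookup w z - lookup v z - lookup w z = 0" for z
      unfolding v[of z "lookup w z"] by simp
    ultimately show "x \<otimes>\<^bsub>?W\<^esub> y \<otimes>\<^bsub>?W\<^esub> inv\<^bsub>?W\<^esub> x \<otimes>\<^bsub>?W\<^esub> inv\<^bsub>?W\<^esub> y \<in> {\<one>\<^bsub>?W\<^esub>}"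
      by (auto intro!: poly_mapping_eqI simp: lookup_add)
  qed
  then have "derived ?W (derived ?W (derived ?W UNIV)) \<subseteq> {\<one>\<^bsub>?W\<^esub>}"
    using mono_derived[OF 2] by auto
  moreover have "\<one>\<^bsub>?W\<^esub> \<in> derived ?W (derived ?W (derived ?W UNIV))"
    by (intro subgroup.one_closed derived_is_subgroup) simp
  ultimately have "(derived ?W ^^ 3) (carrier ?W) = {\<one>\<^bsub>?W\<^esub>}"
    by (auto simp: numeral_3_eq_3)
  then show ?thesis unfolding solvable_iff_trivial_derived_seq by blast
qed

section \<open>An automorphism of the wreath product and its Lang map\<close>

definition twist :: "('l \<Rightarrow> 'l) \<Rightarrow> ('h::ab_group_add \<Rightarrow>\<^sub>0 'l::zero) \<Rightarrow> ('h \<Rightarrow>\<^sub>0 'l)"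
  where "twist \<alpha> v = Poly_Mapping.map_key uminus (Poly_Mapping.map \<alpha> v)"

lemma lookup_twist: "\<alpha> 0 = 0 \<Longrightarrow> lookup (twist \<alpha> v) x = \<alpha> (lookup v (- x))"
  by (simp add: twist_def map_key.rep_eq map.rep_eq when_def)

definition wreath_aut ::
    "('l \<Rightarrow> 'l) \<Rightarrow> ('h::ab_group_add \<Rightarrow>\<^sub>0 'l::group_add) \<times> 'h \<Rightarrow> ('h \<Rightarrow>\<^sub>0 'l) \<times> 'h"
  where "wreath_aut \<alpha> = (\<lambda>(v, h). (twist \<alpha> v, - h))"

lemma additive_zero: "\<alpha> 0 = 0" if "\<And>x y. \<alpha> (x + y) = \<alpha> x + \<alpha> y" for \<alpha> :: "'l::group_add \<Rightarrow> 'l"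
  using that[of 0 0] add_left_imp_eq[of "\<alpha> 0" "\<alpha> 0" 0] by simp

lemma bij_twist:
  assumes "\<alpha> 0 = 0" "bij \<alpha>"
  shows "bij (twist \<alpha> :: ('h::ab_group_add \<Rightarrow>\<^sub>0 'l::zero) \<Rightarrow> _)"
proof (rule o_bij)
  have 0: "inv_into UNIV \<alpha> 0 = 0" using assms by (metis bij_is_inj inv_f_f)
  show "twist (inv_into UNIV \<alpha>) \<circ> twist \<alpha> = id"
    by (auto intro!: ext poly_mapping_eqI simp: lookup_twist assms 0 bij_is_inj)
  show "twist \<alpha> \<circ> twist (inv_into UNIV \<alpha>) = id"
    using assms(2) by (auto intro!: ext poly_mapping_eqI simp: lookup_twist assms(1) 0 bij_is_surj surj_f_inv_f)
qed

text \<open>Reflecting the positions turns a shift by \<open>h\<close> into one by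
  \<open>- h\<close>, which matches the inversion of the top group in
  \<open>wreath_aut\<close>.\<close>

lemma twist_add:
  fixes \<alpha> :: "'l::group_add \<Rightarrow> 'l"
  assumes "\<And>x y. \<alpha> (x + y) = \<alpha> x + \<alpha> y"
  shows "twist \<alpha> (v + shift h w) = twist \<alpha> v + shift (- h) (twist \<alpha> w)"
proof (rule poly_mapping_eqI)
  have "- x - h = - (x - - h)" for x by simp
  then show "lookup (twist \<alpha> (v + shift h w)) x = lookup (twist \<alpha> v + shift (- h) (twist \<alpha> w)) x" for x
    by (simp only: lookup_twist[of \<alpha>, OF additive_zero[OF assms]] lookup_add lookup_shift assms)
qed

lemma wreath_aut_iso:
  fixes \<alpha> :: "'l::group_add \<Rightarrow> 'l"
  assumes "\<And>x y. \<alpha> (x + y) = \<alpha> x + \<alpha> y" "bij \<alpha>"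
  shows "wreath_aut \<alpha> \<in> iso (wreath :: (('h::ab_group_add \<Rightarrow>\<^sub>0 'l) \<times> 'h) monoid) wreath"
proof (rule isoI)
  show "wreath_aut \<alpha> \<in> hom wreath wreath"
    by (rule homI) (auto simp: wreath_aut_def twist_add[OF assms(1)])
  let ?f = "twist \<alpha> :: ('h \<Rightarrow>\<^sub>0 'l) \<Rightarrow> _" and ?g = "uminus :: 'h \<Rightarrow> _"
  have eq: "wreath_aut \<alpha> = map_prod ?f ?g" by (auto simp: wreath_aut_def)
  have "bij (map_prod ?f ?g)"
    using bij_twist[OF additive_zero[OF assms(1)] assms(2)]
    by (intro bijI prod.inj_map map_prod_surj surjI[of uminus uminus])
      (auto dest: bij_is_inj bij_is_surj simp: inj_def)
  then show "bij_betw (wreath_aut \<alpha>) (carrier wreath) (carrier (wreath :: (('h \<Rightarrow>\<^sub>0 'l) \<times> 'h) monoid))"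
    unfolding wreath_simps eq .
qed

text \<open>The top component asks for \<open>c + c = h\<close>. In the base component
  \<open>shift h\<close> and \<open>twist\<close> together couple only the positions
  \<open>z\<close> and \<open>h - z\<close>, so two applications of \<alpha> lead back to the same
  position.\<close>

lemma wreath_lang:
  fixes x :: "('h::ab_group_add \<Rightarrow>\<^sub>0 'l::group_add) \<times> 'h"
  assumes add: "\<And>x y. \<alpha> (x + y) = \<alpha> x + \<alpha> y"
    and solve: "\<And>k :: 'l. \<exists>!y. y = k + \<alpha> (\<alpha> y)"
    and half: "\<And>h :: 'h. \<exists>c. c + c = h"
  shows "\<exists>g. g = x \<otimes>\<^bsub>wreath\<^esub> wreath_aut \<alpha> g"
proof -
  obtain k h where x: "x = (k, h)" by (cases x)
  obtain c where c: "c + c = h" using half by blast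
  have zero: "\<alpha> 0 = 0" by (rule additive_zero[OF add])
  define sol where "sol m = (THE y. y = m + \<alpha> (\<alpha> y))" for m
  have sol: "sol m = m + \<alpha> (\<alpha> (sol m))" for m
    unfolding sol_def by (rule theI'[OF solve])
  have unique: "y = sol m" if "y = m + \<alpha> (\<alpha> y)" for y m
    using solve[of m] sol[of m] that by blast
  define w where "w = Abs_poly_mapping (\<lambda>z. sol (lookup k z + \<alpha> (lookup k (h - z))))"
  \<comment> \<open>This keeps the support of \<open>w\<close> finite: off \<open>keys k\<close> and
    its reflection the argument of \<open>sol\<close> is 0.\<close>
  have "sol 0 = 0" using unique[of 0 0] zero by simp
  have "{z. sol (lookup k z + \<alpha> (lookup k (h - z))) \<noteq> 0} \<subseteq> keys k \<union> (\<lambda>z. h - z) ` keys k"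
  proof (intro subsetI)
    fix z assume z: "z \<in> {z. sol (lookup k z + \<alpha> (lookup k (h - z))) \<noteq> 0}"
    show "z \<in> keys k \<union> (\<lambda>z. h - z) ` keys k"
    proof (rule ccontr)
      assume "\<not> ?thesis"
      then have "z \<notin> keys k" "h - z \<notin> keys k" using imageI[of "h - z" "keys k" "\<lambda>z. h - z"] by auto
      then have "lookup k z = 0" "lookup k (h - z) = 0" by (simp_all add: in_keys_iff)
      then show False using z \<open>sol 0 = 0\<close> zero by simp
    qed
  qed
  then have "finite {z. sol (lookup k z + \<alpha> (lookup k (h - z))) \<noteq> 0}"
    by (rule finite_subset) simp
  then have w: "lookup w z = sol (lookup k z + \<alpha> (lookup k (h - z)))" for z
    by (simp add: w_def)
  \<comment> \<open>The equation at \<open>z\<close> involves the value at \<open>h - z\<close>; substituting the equation at \<open>h - z\<close>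
    eliminates that value and leaves the equation defining \<open>sol\<close>.\<close>
  have w_eq: "lookup w z = lookup k z + \<alpha> (lookup w (h - z))" for z
  proof -
    let ?u = "lookup k z + \<alpha> (lookup w (h - z))"
    have sw: "lookup w (h - z) = sol (lookup k (h - z) + \<alpha> (lookup k z))" by (simp add: w)
    have "lookup w (h - z) = lookup k (h - z) + \<alpha> (lookup k z) + \<alpha> (\<alpha> (lookup w (h - z)))"
      unfolding sw by (rule sol)
    also have "\<dots> = lookup k (h - z) + \<alpha> ?u" by (simp add: add add.assoc)
    finally have "?u = lookup k z + \<alpha> (lookup k (h - z) + \<alpha> ?u)" by (rule arg_cong)
    also have "\<dots> = lookup k z + \<alpha> (lookup k (h - z)) + \<alpha> (\<alpha> ?u)"
      by (simp only: add add.assoc)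
    finally have "?u = lookup k z + \<alpha> (lookup k (h - z)) + \<alpha> (\<alpha> ?u)" .
    from unique[OF this] show ?thesis by (simp only: w)
  qed
  have "w = k + shift h (twist \<alpha> w)"
  proof (rule poly_mapping_eqI)
    fix z
    have "lookup (k + shift h (twist \<alpha> w)) z = lookup k z + \<alpha> (lookup w (h - z))"
      by (simp add: lookup_add lookup_twist[of \<alpha>, OF zero])
    then show "lookup w z = lookup (k + shift h (twist \<alpha> w)) z" by (rule trans[OF w_eq sym])
  qed
  moreover have "c = h + - c" using c by (simp add: algebra_simps)
  moreover have "x \<otimes>\<^bsub>wreath\<^esub> wreath_aut \<alpha> (w, c) = (k + shift h (twist \<alpha> w), h + - c)"
    by (simp add: x wreath_aut_def)
  ultimately have "(w, c) = x \<otimes>\<^bsub>wreath\<^esub> wreath_aut \<alpha> (w, c)" by metis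
  then show ?thesis by blast
qed

section \<open>The top group: countability, local finiteness, infinitude\<close>

instance poly_mapping :: (countable, "{zero, countable}") countable
proof
  \<comment> \<open>The graph over the support determines the function, which embeds the type into
    the countable collection of finite sets of pairs.\<close>
  define graph where "graph v = (\<lambda>x. (x, lookup v x)) ` keys v" for v :: "'a \<Rightarrow>\<^sub>0 'b"
  have "inj graph"
  proof (intro injI poly_mapping_eqI)
    fix v w :: "'a \<Rightarrow>\<^sub>0 'b" and x assume eq: "graph v = graph w"
    have g: "(x, y) \<in> graph v \<longleftrightarrow> lookup v x = y \<and> y \<noteq> 0" for v :: "'a \<Rightarrow>\<^sub>0 'b" and y :: 'b
      by (auto simp: graph_def in_keys_iff)
    show "lookup v x = lookup w x"
      using g[of "lookup v x" v] g[of "lookup v x" w] g[of "lookup w x" v] g[of "lookup w x" w]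
      unfolding eq by metis
  qed
  moreover have "range graph \<subseteq> Collect finite" by (auto simp: graph_def)
  then have "countable (range graph)" by (rule countable_subset) (rule countable_Collect_finite)
  ultimately have "countable (UNIV :: ('a \<Rightarrow>\<^sub>0 'b) set)" by (metis countable_image_inj_on)
  then show "\<exists>f :: ('a \<Rightarrow>\<^sub>0 'b) \<Rightarrow> nat. inj f" by (rule countableE) blast
qed

text \<open>The functions supported in the union of the given supports form a subgroup, finite
  because the values come from a finite type.\<close>

lemma locally_finite_poly_mapping:
  "locally_finite TYPE('i \<Rightarrow>\<^sub>0 'f::{ab_group_add, finite})"
  unfolding locally_finite_def
proof (intro allI impI)
  fix S :: "('i \<Rightarrow>\<^sub>0 'f) set" assume S: "finite S"
  let ?K = "{v :: 'i \<Rightarrow>\<^sub>0 'f. keys v \<subseteq> (\<Union>s\<in>S. keys s)}"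
  have "finite ?K" using S by (intro finite_keys_subset) auto
  moreover have "keys (x - y) \<subseteq> keys x \<union> keys y" for x y :: "'i \<Rightarrow>\<^sub>0 'f"
    by (auto simp: in_keys_iff lookup_minus)
  then have "\<forall>x\<in>?K. \<forall>y\<in>?K. x - y \<in> ?K" by blast
  ultimately show "\<exists>K. finite K \<and> S \<subseteq> K \<and> 0 \<in> K \<and> (\<forall>x\<in>K. \<forall>y\<in>K. x - y \<in> K)"
    by (intro exI[of _ ?K]) auto
qed

lemma infinite_poly_mapping:
  assumes "infinite (UNIV :: 'i set)"
  shows "infinite (UNIV :: ('i \<Rightarrow>\<^sub>0 'f::zero_neq_one) set)"
proof
  assume "finite (UNIV :: ('i \<Rightarrow>\<^sub>0 'f) set)"
  moreover have "inj (\<lambda>i :: 'i. Poly_Mapping.single i (1 :: 'f))"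
    by (rule injI) (metis lookup_single_eq lookup_single_not_eq zero_neq_one)
  ultimately show False using assms finite_imageD[of "\<lambda>i :: 'i. Poly_Mapping.single i (1 :: 'f)" UNIV]
    by (metis finite_subset subset_UNIV)
qed

section \<open>The Heisenberg group modulo 7\<close>

text \<open>\<open>Heis a b c\<close> stands for the upper unitriangular 3 by 3 matrix over the
  integers modulo 7 with superdiagonal \<open>a\<close>, \<open>b\<close> and corner
  \<open>c\<close>; the additive notation denotes matrix multiplication.\<close>

datatype heis = Heis 7 7 7

instantiation heis :: group_add
begin

definition "0 = Heis 0 0 0"
fun plus_heis where "Heis a b c + Heis a' b' c' = Heis (a + a') (b + b') (c + c' + a * b')"
fun uminus_heis where "- Heis a b c = Heis (- a) (- b) (a * b - c)"
definition "x - y = x + - y" for x y :: heis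

instance
proof
  fix x y z :: heis
  show "x + y + z = x + (y + z)"
    by (cases x; cases y; cases z) (simp add: algebra_simps)
  show "0 + x = x" "x + 0 = x" "- x + x = 0"
    by (cases x; simp add: zero_heis_def)+
  show "x + - y = x - y" by (simp add: minus_heis_def)
qed

end

instance heis :: finite
proof
  have "(UNIV :: heis set) = (\<lambda>(a, b, c). Heis a b c) ` UNIV"
    by (auto simp: image_iff) (metis heis.exhaust)
  moreover have "finite ((\<lambda>(a, b, c). Heis a b c) ` UNIV)" by (rule finite_imageI) (rule finite)
  ultimately show "finite (UNIV :: heis set)" by (rule ssubst)
qed

lemma heis_commutator_central: "a + b - a - b + c = c + (a + b - a - b)" for a b c :: heis
  by (cases a; cases b; cases c) (simp add: minus_heis_def algebra_simps)

text \<open>The square of the automorphism below multiplies the entries by 4, 4 and 16. Modulo 7 none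
  of these factors is 1, which makes \<open>heis_solve\<close> possible.\<close>

fun heis_aut :: "heis \<Rightarrow> heis" where "heis_aut (Heis a b c) = Heis (2 * a) (2 * b) (4 * c)"

lemma heis_aut_add: "heis_aut (x + y) = heis_aut x + heis_aut y"
  by (cases x; cases y) (simp add: algebra_simps)

text \<open>Equality modulo 7 is certified by an explicit multiple of 7, whose cofactor
  \<open>z\<close> is the witness at each use.\<close>

lemma eq_mod_7: "x = y" if "x - y = 7 * z" for x y z :: 7
proof -
  have seven: "(7 :: 7) = 0" by simp
  have "x - y = 0 * z" using that by (simp only: seven)
  then show ?thesis by simp
qed

text \<open>Since 1 + 3 * 2 = 7, the inverse of 2 modulo 7 is -3.\<close>

lemma double_cancel: "x = y" if "2 * x = 2 * y" for x y :: 7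
proof (rule eq_mod_7)
  have "7 * (x - y) = (x - y) + 3 * (2 * x - 2 * y)" by (simp add: algebra_simps)
  then show "x - y = 7 * (x - y)" using that by simp
qed

lemma heis_solve: "\<exists>!y. y = k + heis_aut (heis_aut y)"
proof -
  obtain a b c where k: "k = Heis a b c" by (cases k)
  have rec: "k + heis_aut (heis_aut (Heis p q r)) = Heis (a + 4 * p) (b + 4 * q) (c + 16 * r + a * (4 * q))"
    for p q r by (simp add: k mult.assoc[symmetric])
  show ?thesis
  proof (rule ex1I)
    \<comment> \<open>Modulo 7 the inverses of 1 - 4 and 1 - 16 are 2 and -1. The extra term
      \<open>a * (4 * (2 * b))\<close> in the last entry equals \<open>a * b\<close> because 8 = 1,
      whence \<open>- c - a * b\<close>.\<close>
    have "2 * a = a + 4 * (2 * a)" "2 * b = b + 4 * (2 * b)"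
      by (rule eq_mod_7[of _ _ "- _"], simp)+
    moreover have "- c - a * b = c + 16 * (- c - a * b) + a * (4 * (2 * b))"
      by (rule eq_mod_7[of _ _ "2 * c + a * b"]) (simp add: algebra_simps)
    ultimately show "Heis (2 * a) (2 * b) (- c - a * b)
        = k + heis_aut (heis_aut (Heis (2 * a) (2 * b) (- c - a * b)))"
      unfolding rec by (intro arg_cong3[where f = Heis])
    fix y assume y: "y = k + heis_aut (heis_aut y)"
    obtain p q r where pqr: "y = Heis p q r" by (cases y)
    have p: "p = a + 4 * p" and q: "q = b + 4 * q" and r: "r = c + 16 * r + a * (4 * q)"
      using y unfolding pqr rec heis.inject by blast+
    have a: "a = p - 4 * p" and b: "b = q - 4 * q" and c: "c = r - (16 * r + a * (4 * q))"
      by (rule eq_diff_eq[THEN iffD2, OF p[symmetric]] eq_diff_eq[THEN iffD2, OF q[symmetric]]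
          eq_diff_eq[THEN iffD2, OF r[unfolded add.assoc, symmetric]])+
    have p2: "p = 2 * a" by (rule eq_mod_7[of _ _ p]) (subst a, simp add: algebra_simps)
    have q2: "q = 2 * b" by (rule eq_mod_7[of _ _ q]) (subst b, simp add: algebra_simps)
    have "r = - c - a * b"
      by (rule eq_mod_7[of _ _ "- 2 * r - a * b"]) (simp add: c q2 algebra_simps)
    with p2 q2 show "y = Heis (2 * a) (2 * b) (- c - a * b)" by (simp only: pqr)
  qed
qed

lemma bij_heis_aut: "bij heis_aut"
proof -
  have "inj heis_aut"
  proof (rule injI)
    fix x y assume eq: "heis_aut x = heis_aut y"
    obtain a b c where x: "x = Heis a b c" by (cases x)
    obtain a' b' c' where y: "y = Heis a' b' c'" by (cases y)
    have e: "2 * a = 2 * a'" "2 * b = 2 * b'" "2 * (2 * c) = 2 * (2 * c')" using eq unfolding x y by simp_all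
    show "x = y" by (simp only: x y double_cancel[OF e(1)] double_cancel[OF e(2)]
        double_cancel[OF double_cancel[OF e(3)]])
  qed
  then show ?thesis using finite_UNIV_inj_surj[of heis_aut] by (simp add: bij_def)
qed

lemma three_torsion: "h + h + h = 0" for h :: "nat \<Rightarrow>\<^sub>0 3"
proof (rule poly_mapping_eqI)
  have 3: "(3 :: 3) = 0" by simp
  have "z + z + z = 3 * z" for z :: 3 by (simp add: algebra_simps)
  then have "z + z + z = 0" for z :: 3 by (simp only: 3 mult_zero_left)
  then show "lookup (h + h + h) x = lookup 0 x" for x by (simp only: lookup_add lookup_zero)
qed

section \<open>Transport to the natural numbers\<close>

text \<open>For bijective \<open>d\<close> this structure makes \<open>d\<close> an isomorphism onto
  \<open>W\<close>; it serves to put the countable wreath product on the type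
  \<open>nat\<close>.\<close>

definition pullback :: "('b \<Rightarrow> 'a) \<Rightarrow> 'a monoid \<Rightarrow> 'b monoid"
  where "pullback d W = \<lparr>carrier = UNIV, monoid.mult = (\<lambda>m n. inv_into UNIV d (d m \<otimes>\<^bsub>W\<^esub> d n)),
    one = inv_into UNIV d \<one>\<^bsub>W\<^esub>\<rparr>"

locale pullback_group = group W for W :: "'a monoid" +
  fixes d :: "'b \<Rightarrow> 'a"
  assumes carrier_W [simp]: "carrier W = UNIV" and bij_d: "bij d"
begin

abbreviation G where "G \<equiv> pullback d W"

lemma inv_d [simp]: "d (inv_into UNIV d x) = x" "inv_into UNIV d (d m) = m"
  using bij_d by (simp_all add: bij_is_surj surj_f_inv_f bij_is_inj)

lemma d_eq_iff: "d m = d n \<longleftrightarrow> m = n"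
  using bij_d by (metis bij_is_inj inj_eq)

lemma carrier_pullback [simp]: "carrier G = UNIV"
  by (simp add: pullback_def)

lemma d_mult [simp]: "d (m \<otimes>\<^bsub>G\<^esub> n) = d m \<otimes>\<^bsub>W\<^esub> d n" and d_one [simp]: "d \<one>\<^bsub>G\<^esub> = \<one>\<^bsub>W\<^esub>"
  by (simp_all add: pullback_def)

lemma group_pullback: "group G"
proof (rule groupI)
  fix m
  have "inv_into UNIV d (inv\<^bsub>W\<^esub> d m) \<otimes>\<^bsub>G\<^esub> m = \<one>\<^bsub>G\<^esub>" by (simp flip: d_eq_iff)
  then show "\<exists>n\<in>carrier G. n \<otimes>\<^bsub>G\<^esub> m = \<one>\<^bsub>G\<^esub>" by auto
qed (simp_all add: m_assoc flip: d_eq_iff)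

lemma d_hom: "group_hom G W d"
  by (simp add: group_hom_def group_hom_axioms_def group_pullback is_group hom_def)

lemma d_inv [simp]: "d (inv\<^bsub>G\<^esub> m) = inv\<^bsub>W\<^esub> d m"
  using group_hom.hom_inv[OF d_hom, of m] by simp

lemma solvable_pullback: "solvable W \<Longrightarrow> solvable G"
  using bij_d by (intro group_hom.inj_hom_imp_solvable[OF d_hom]) (auto dest: bij_is_inj)

lemma amenable_pullback:
  assumes "amenable W"
  shows "amenable G"
proof -
  obtain \<mu> where \<mu>: "\<mu> UNIV = 1" "\<And>A. 0 \<le> \<mu> A"
      "\<And>A B. A \<inter> B = {} \<Longrightarrow> \<mu> (A \<union> B) = \<mu> A + \<mu> B" "\<And>g A. \<mu> (g <#\<^bsub>W\<^esub> A) = (\<mu> A :: real)"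
    using assms unfolding amenable_def by auto
  have "d ` (g <#\<^bsub>G\<^esub> A) = d g <#\<^bsub>W\<^esub> (d ` A)" for g A
    by (simp add: l_coset_def image_UN)
  moreover have "d ` A \<inter> d ` B = {}" if "A \<inter> B = {}" for A B
    using that bij_is_inj[OF bij_d] by (simp add: image_Int[symmetric])
  ultimately show ?thesis
    unfolding amenable_def using \<mu> bij_is_surj[OF bij_d]
    by (intro exI[of _ "\<lambda>A. \<mu> (d ` A)"]) (simp add: image_Un)
qed

lemma iso_pullback:
  assumes "f \<in> iso W W"
  shows "inv_into UNIV d \<circ> f \<circ> d \<in> iso G G"
proof (rule isoI)
  have f: "f (x \<otimes>\<^bsub>W\<^esub> y) = f x \<otimes>\<^bsub>W\<^esub> f y" "bij f" for x y
    using assms by (auto simp: iso_def hom_def)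
  show "inv_into UNIV d \<circ> f \<circ> d \<in> hom G G"
    by (rule homI) (simp_all add: f flip: d_eq_iff)
  show "bij_betw (inv_into UNIV d \<circ> f \<circ> d) (carrier G) (carrier G)"
    using bij_comp[OF bij_d bij_comp[OF f(2) bij_imp_bij_inv[OF bij_d]]] by (simp add: comp_assoc)
qed

end

section \<open>The counterexample\<close>

theorem theorem1p5:
  shows "\<exists>(G :: nat monoid) \<phi>.
    group G \<and> countable (carrier G) \<and> solvable G \<and> amenable G \<and> \<not> type_I_group G \<and>
    \<phi> \<in> iso G G \<and>
    reidemeister_number G \<phi> \<noteq> \<infinity> \<and>
    reidemeister_number G \<phi> \<noteq> dual_fixed_points G \<phi>"
proof -
  let ?W = "wreath :: (((nat \<Rightarrow>\<^sub>0 3) \<Rightarrow>\<^sub>0 heis) \<times> (nat \<Rightarrow>\<^sub>0 3)) monoid"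
  have lf: "locally_finite TYPE(nat \<Rightarrow>\<^sub>0 3)" by (rule locally_finite_poly_mapping)
  have inf: "infinite (UNIV :: (nat \<Rightarrow>\<^sub>0 3) set)" by (rule infinite_poly_mapping) simp
  then have "infinite (UNIV :: (((nat \<Rightarrow>\<^sub>0 3) \<Rightarrow>\<^sub>0 heis) \<times> (nat \<Rightarrow>\<^sub>0 3)) set)"
    by (simp add: finite_prod)
  then obtain e :: "((nat \<Rightarrow>\<^sub>0 3) \<Rightarrow>\<^sub>0 heis) \<times> (nat \<Rightarrow>\<^sub>0 3) \<Rightarrow> nat" where "bij e"
    by (rule countableE_infinite[OF countableI_type])
  define d where "d = inv_into UNIV e"
  interpret P: pullback_group ?W d
    by (intro pullback_group.intro pullback_group_axioms.intro group_wreath)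
      (simp_all add: d_def bij_imp_bij_inv \<open>bij e\<close>)
  define \<phi> where "\<phi> = inv_into UNIV d \<circ> wreath_aut heis_aut \<circ> d"
  have iso: "\<phi> \<in> iso P.G P.G"
    unfolding \<phi>_def by (intro P.iso_pullback wreath_aut_iso heis_aut_add bij_heis_aut)
  have d\<phi>: "d (\<phi> m) = wreath_aut heis_aut (d m)" for m by (simp add: \<phi>_def)
  have "amenable ?W"
    by (rule amenable_locally_finite[OF group_wreath wreath_locally_finite[OF lf]])
  then have amenable: "amenable P.G" by (rule P.amenable_pullback)
  have solvable: "solvable P.G"
    by (intro P.solvable_pullback solvable_wreath heis_commutator_central)
  \<comment> \<open>The two elementary matrices in positions \<open>a\<close> and \<open>b\<close>
    differ in the corner of their products.\<close>
  have "Heis 1 0 0 + Heis 0 1 0 \<noteq> Heis 0 1 0 + Heis 1 0 0" by simp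
  note noncomm = wreath_noncommuting[OF lf inf this]
  have not_I: "\<not> type_I_group P.G"
  proof (rule regular_rep_not_type_I[OF P.group_pullback P.carrier_pullback])
    fix F :: "nat set" assume "finite F"
    then have "finite (d ` F)" by simp
    from noncomm[OF this] obtain a b where ab: "\<forall>x\<in>d ` F. a \<otimes>\<^bsub>?W\<^esub> x = x \<otimes>\<^bsub>?W\<^esub> a \<and> b \<otimes>\<^bsub>?W\<^esub> x = x \<otimes>\<^bsub>?W\<^esub> b"
        "b \<otimes>\<^bsub>?W\<^esub> a \<otimes>\<^bsub>?W\<^esub> inv\<^bsub>?W\<^esub> (a \<otimes>\<^bsub>?W\<^esub> b) \<notin> d ` F"
      by (elim exE conjE)
    let ?a = "inv_into UNIV d a" and ?b = "inv_into UNIV d b"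
    have "\<forall>x\<in>F. ?a \<otimes>\<^bsub>P.G\<^esub> x = x \<otimes>\<^bsub>P.G\<^esub> ?a \<and> ?b \<otimes>\<^bsub>P.G\<^esub> x = x \<otimes>\<^bsub>P.G\<^esub> ?b"
      using ab(1) by (simp flip: P.d_eq_iff del: wreath_simps)
    moreover have "d (?b \<otimes>\<^bsub>P.G\<^esub> ?a \<otimes>\<^bsub>P.G\<^esub> inv\<^bsub>P.G\<^esub> (?a \<otimes>\<^bsub>P.G\<^esub> ?b)) \<notin> d ` F"
      using ab(2) by simp
    then have "?b \<otimes>\<^bsub>P.G\<^esub> ?a \<otimes>\<^bsub>P.G\<^esub> inv\<^bsub>P.G\<^esub> (?a \<otimes>\<^bsub>P.G\<^esub> ?b) \<notin> F" by blast
    ultimately show "\<exists>a b. (\<forall>x\<in>F. a \<otimes>\<^bsub>P.G\<^esub> x = x \<otimes>\<^bsub>P.G\<^esub> a \<and> b \<otimes>\<^bsub>P.G\<^esub> x = x \<otimes>\<^bsub>P.G\<^esub> b)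
        \<and> b \<otimes>\<^bsub>P.G\<^esub> a \<otimes>\<^bsub>P.G\<^esub> inv\<^bsub>P.G\<^esub> (a \<otimes>\<^bsub>P.G\<^esub> b) \<notin> F" by blast
  qed
  have R: "reidemeister_number P.G \<phi> = 1"
  proof (rule reidemeister_number_eq_1[OF P.group_pullback iso])
    fix m
    \<comment> \<open>Exponent 3 gives \<open>- h + - h = h\<close>, so \<open>- h\<close> is half
      of \<open>h\<close>.\<close>
    have half: "\<exists>c. c + c = h" for h :: "nat \<Rightarrow>\<^sub>0 3"
      using three_torsion[of h] by (intro exI[of _ "- h"]) (simp add: add_eq_0_iff2 algebra_simps)
    obtain g where g: "g = d m \<otimes>\<^bsub>?W\<^esub> wreath_aut heis_aut g"
      using wreath_lang[OF heis_aut_add heis_solve half] by metis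
    let ?g = "inv_into UNIV d g"
    have "d (m \<otimes>\<^bsub>P.G\<^esub> \<phi> ?g) = d ?g" using g by (simp only: P.d_mult d\<phi> P.inv_d)
    then have "?g = m \<otimes>\<^bsub>P.G\<^esub> \<phi> ?g" by (simp only: P.d_eq_iff)
    then show "\<exists>g\<in>carrier P.G. g = m \<otimes>\<^bsub>P.G\<^esub> \<phi> g" by auto
  qed
  interpret A: mixing_action P.G "\<lambda>m. wreath_act (d m)" 0
  proof (intro mixing_action.intro permutation_action.intro permutation_action_axioms.intro
      mixing_action_axioms.intro P.group_pullback)
    show "wreath_act (d \<one>\<^bsub>P.G\<^esub>) w = w" for w by (simp add: wreath_act_def)
    show "wreath_act (d (m \<otimes>\<^bsub>P.G\<^esub> n)) w = wreath_act (d m) (wreath_act (d n) w)" for m n w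
      by (simp add: wreath_act_mult)
    show "\<exists>m\<in>carrier P.G. wreath_act (d m) 0 = w" for w
      by (rule bexI[of _ "inv_into UNIV d (w, 0)"]) (simp_all add: wreath_act_def)
    fix S :: "((nat \<Rightarrow>\<^sub>0 3) \<Rightarrow>\<^sub>0 heis) set" assume "finite S" "0 \<notin> S"
    then obtain g where "wreath_act g 0 = 0 \<and> wreath_act g ` S \<inter> S = {}"
      using wreath_mixing[OF lf inf] by metis
    then show "\<exists>m\<in>carrier P.G. wreath_act (d m) 0 = 0 \<and> wreath_act (d m) ` S \<inter> S = {}"
      by (intro bexI[of _ "inv_into UNIV d g"]) simp_all
  qed
  have "dual_fixed_points P.G \<phi> \<noteq> 1"
  proof (rule A.dual_fixed_points_ne_1[OF iso])
    \<comment> \<open>\<open>twist heis_aut\<close> is the map that \<phi> induces on the cosets of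
      the top group.\<close>
    show "bij (twist heis_aut :: ((nat \<Rightarrow>\<^sub>0 3) \<Rightarrow>\<^sub>0 heis) \<Rightarrow> _)"
      by (intro bij_twist additive_zero heis_aut_add bij_heis_aut)
    show "twist heis_aut (wreath_act (d m) w) = wreath_act (d (\<phi> m)) (twist heis_aut w)" for m w
      by (cases "d m") (simp add: d\<phi> wreath_act_def wreath_aut_def twist_add[OF heis_aut_add])
    \<comment> \<open>A single nonzero lamp gives a coset other than the base point, so this
      representation is not the trivial one.\<close>
    have "lookup (Poly_Mapping.single 0 (Heis 1 0 0)) 0 \<noteq> lookup 0 (0 :: nat \<Rightarrow>\<^sub>0 3)"
      by (simp add: zero_heis_def)
    then show "Poly_Mapping.single 0 (Heis 1 0 0) \<noteq> (0 :: (nat \<Rightarrow>\<^sub>0 3) \<Rightarrow>\<^sub>0 heis)" by metis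
  qed
  with R have "reidemeister_number P.G \<phi> \<noteq> \<infinity>" "reidemeister_number P.G \<phi> \<noteq> dual_fixed_points P.G \<phi>"
    by (auto simp: one_enat_def)
  then show ?thesis
    using P.group_pullback solvable amenable not_I iso
    by (intro exI[of _ "P.G"] exI[of _ \<phi>]) auto
qed

end
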